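(* Let $F$ be a graph such that $\mathrm{ex}(n,K_3,F)=o(n^2)$. Then $\mathrm{th}(F)\le (\chi(F)-1)(|V(F)|-1)+1$.
   Context: $\mathrm{ex}(n,H,F)$ (generalized Turán number) is the maximum number of copies of $H$ in an $F$-free $n$-vertex graph; asymptotics are as $n\to\infty$. A hypergraph $\mathcal{H}$ is a Berge copy of a graph $G$ if $V(G)\subseteq V(\mathcal{H})$ and there is a bijection $f:E(G)\to E(\mathcal{H})$ with $e\subseteq f(e)$ for all $e\in E(G)$. $\mathrm{ex}_r(n,\text{Berge-}F)$ is the maximum number of hyperedges in an $r$-uniform $n$-vertex hypergraph with no Berge copy of $F$. For every $F$ there is $r_0$ with $\mathrm{ex}_r(n,\text{Berge-}F)=o(n^2)$ for all $r\ge r_0$; the uniformity threshold $\mathrm{th}(F)$ is the smallest such $r_0$. $\chi(F)$ is the chromatic number of $F$. *)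

theory Defs
  imports Main "HOL-Library.Landau_Symbols"
begin

definition graph_on :: "'a set \<Rightarrow> 'a set set \<Rightarrow> bool" where
  "graph_on V E \<longleftrightarrow> finite V \<and> (\<forall>e\<in>E. e \<subseteq> V \<and> card e = 2)"

definition host_graph :: "nat \<Rightarrow> nat set set \<Rightarrow> bool" where
  "host_graph n G \<longleftrightarrow> (\<forall>e\<in>G. e \<subseteq> {..<n} \<and> card e = 2)"

definition contains_copy :: "'a set \<Rightarrow> 'a set set \<Rightarrow> nat \<Rightarrow> nat set set \<Rightarrow> bool" where
  "contains_copy V E n G \<longleftrightarrow>
     (\<exists>\<phi>. inj_on \<phi> V \<and> \<phi> ` V \<subseteq> {..<n} \<and> (\<forall>e\<in>E. \<phi> ` e \<in> G))"

definition triangles :: "nat \<Rightarrow> nat set set \<Rightarrow> nat" where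
  "triangles n G = card {T. T \<subseteq> {..<n} \<and> card T = 3 \<and>
                            (\<forall>x\<in>T. \<forall>y\<in>T. x \<noteq> y \<longrightarrow> {x, y} \<in> G)}"

definition ex_K3 :: "'a set \<Rightarrow> 'a set set \<Rightarrow> nat \<Rightarrow> nat" where
  "ex_K3 V E n = Sup {triangles n G | G. host_graph n G \<and> \<not> contains_copy V E n G}"

definition uniform_hypergraph :: "nat \<Rightarrow> nat \<Rightarrow> nat set set \<Rightarrow> bool" where
  "uniform_hypergraph r n H \<longleftrightarrow> (\<forall>h\<in>H. h \<subseteq> {..<n} \<and> card h = r)"

definition contains_berge :: "'a set \<Rightarrow> 'a set set \<Rightarrow> nat \<Rightarrow> nat set set \<Rightarrow> bool" where
  "contains_berge V E n H \<longleftrightarrow>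
     (\<exists>\<phi> f. inj_on \<phi> V \<and> \<phi> ` V \<subseteq> {..<n} \<and> inj_on f E \<and>
            (\<forall>e\<in>E. f e \<in> H \<and> \<phi> ` e \<subseteq> f e))"

definition ex_berge :: "'a set \<Rightarrow> 'a set set \<Rightarrow> nat \<Rightarrow> nat \<Rightarrow> nat" where
  "ex_berge V E r n =
     Sup {card H | H. uniform_hypergraph r n H \<and> \<not> contains_berge V E n H}"

definition threshold :: "'a set \<Rightarrow> 'a set set \<Rightarrow> nat" where
  "threshold V E = (LEAST r0. \<forall>r\<ge>r0. (\<lambda>n. real (ex_berge V E r n)) \<in> o(\<lambda>n. real n ^ 2))"

definition chromatic_number :: "'a set \<Rightarrow> 'a set set \<Rightarrow> nat" where
  "chromatic_number V E = (LEAST k. \<exists>c :: 'a \<Rightarrow> nat. (\<forall>v\<in>V. c v < k) \<and>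
       (\<forall>e\<in>E. \<forall>u\<in>e. \<forall>v\<in>e. u \<noteq> v \<longrightarrow> c u \<noteq> c v))"

end

theory Submission
  imports Defs "HOL-Analysis.Convex" "HOL-Library.Disjoint_Sets" "HOL-Library.Indicator_Function"
    "HOL-Library.Ramsey"
begin

text \<open>
  Let \<open>H\<close> be an \<open>r\<close>-uniform hypergraph without a Berge copy of \<open>F\<close>, and call a pair heavy if it
  lies in at least \<open>|E(F)|\<close> hyperedges. If \<open>L\<close> is a set of pairs that are contained in distinct
  hyperedges, then the heavy pairs together with \<open>L\<close> form an \<open>F\<close>-free graph, because hyperedges
  for the heavy pairs can be chosen greedily. In particular no hyperedge contains a heavy clique
  of size \<open>|V(F)|\<close>.

  If \<open>F\<close> is bipartite, every hyperedge contains a light pair, and choosing one in each hyperedge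
  gives an \<open>F\<close>-free graph with a constant proportion of \<open>|H|\<close> edges. So \<open>|H| = o(n\<^sup>2)\<close>.

  If \<open>\<chi>(F) \<ge> 3\<close>, consider a hyperedge without a cherry, that is, one in which no light pair forms
  a triangle with two heavy pairs. There heaviness is an equivalence relation whose classes have
  at most \<open>|V(F)| - 1\<close> elements, so there are at least three classes and the hyperedge contains a
  triangle of light pairs. The hyperedges with a cherry give, up to a constant factor, as many
  distinct light pairs, each in a triangle of an \<open>F\<close>-free graph, so there are \<open>O(ex(n, K\<^sub>3, F))\<close>
  of them. The others give, up to a constant factor, as many edge-disjoint light triangles.
  Picking a random edge of each of them leaves an \<open>F\<close>-free graph, so their union has only
  \<open>O(n\<^sup>2 + ex(n, K\<^sub>3, F))\<close> triangles, and by the triangle removal lemma the number of the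
  edge-disjoint triangles is \<open>o(n\<^sup>2)\<close>.
\<close>

section \<open>Averages over the fibers of a map\<close>

definition fiber_avg :: "'w set \<Rightarrow> ('w \<Rightarrow> 'b) \<Rightarrow> ('w \<Rightarrow> real) \<Rightarrow> 'w \<Rightarrow> real" where
  "fiber_avg \<Omega> l g x = (\<Sum>y | y \<in> \<Omega> \<and> l y = l x. g y) / card {y \<in> \<Omega>. l y = l x}"

lemma fiber_avg_cong: "l x = l y \<Longrightarrow> fiber_avg \<Omega> l g x = fiber_avg \<Omega> l g y"
  by (simp add: fiber_avg_def)

lemma fiber_avg_nonneg:
  assumes "\<And>y. y \<in> \<Omega> \<Longrightarrow> 0 \<le> g y"
  shows "0 \<le> fiber_avg \<Omega> l g x"
  unfolding fiber_avg_def using assms by (intro divide_nonneg_nonneg sum_nonneg) auto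

lemma fiber_avg_le_one:
  assumes "\<And>y. y \<in> \<Omega> \<Longrightarrow> g y \<le> 1"
  shows "fiber_avg \<Omega> l g x \<le> 1"
proof -
  let ?F = "{y \<in> \<Omega>. l y = l x}"
  have "sum g ?F \<le> (\<Sum>y\<in>?F. 1)" using assms by (intro sum_mono) auto
  then show ?thesis by (auto simp: fiber_avg_def divide_le_eq_1)
qed

lemma sum_mult_fiber_avg:
  assumes fin: "finite \<Omega>"
    and const: "\<And>x y. x \<in> \<Omega> \<Longrightarrow> y \<in> \<Omega> \<Longrightarrow> l x = l y \<Longrightarrow> w x = w y"
  shows "(\<Sum>x\<in>\<Omega>. w x * fiber_avg \<Omega> l g x) = (\<Sum>x\<in>\<Omega>. w x * g x)"
proof -
  let ?size = "\<lambda>x. real (card {y \<in> \<Omega>. l y = l x})"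
  have "(\<Sum>x\<in>\<Omega>. w x * fiber_avg \<Omega> l g x)
      = (\<Sum>x\<in>\<Omega>. \<Sum>y\<in>\<Omega>. if l y = l x then w x * g y / ?size x else 0)"
    unfolding fiber_avg_def
    by (intro sum.cong refl)
      (simp add: sum.inter_filter[OF fin, symmetric] sum_distrib_left sum_divide_distrib)
  also have "\<dots> = (\<Sum>y\<in>\<Omega>. \<Sum>x\<in>\<Omega>. if l y = l x then w x * g y / ?size x else 0)"
    by (rule sum.swap)
  also have "\<dots> = (\<Sum>y\<in>\<Omega>. \<Sum>x\<in>\<Omega>. if l x = l y then w y * g y / ?size y else 0)"
    by (intro sum.cong refl) (auto dest: const)
  also have "\<dots> = (\<Sum>y\<in>\<Omega>. w y * g y)"
  proof (intro sum.cong refl)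
    fix y assume "y \<in> \<Omega>"
    then have "?size y \<noteq> 0" using fin by auto
    then show "(\<Sum>x\<in>\<Omega>. if l x = l y then w y * g y / ?size y else 0) = w y * g y"
      by (simp add: sum.inter_filter[OF fin, symmetric])
  qed
  finally show ?thesis .
qed

lemma sum_fiber_avg_saturated:
  assumes fin: "finite \<Omega>" and sub: "X \<subseteq> \<Omega>"
    and saturated: "\<And>x y. x \<in> X \<Longrightarrow> y \<in> \<Omega> \<Longrightarrow> l x = l y \<Longrightarrow> y \<in> X"
  shows "(\<Sum>x\<in>X. fiber_avg \<Omega> l g x) = sum g X"
proof -
  have "(\<Sum>x\<in>\<Omega>. indicator X x * fiber_avg \<Omega> l g x) = (\<Sum>x\<in>\<Omega>. indicator X x * g x)"
  proof (rule sum_mult_fiber_avg[OF fin])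
    fix x y assume "x \<in> \<Omega>" "y \<in> \<Omega>" "l x = l y"
    then show "(indicator X x :: real) = indicator X y"
      using saturated[of x y] saturated[of y x] by (auto simp: indicator_def)
  qed
  then show ?thesis using fin sub by (simp add: Int_absorb1)
qed

lemma sum_fiber_avg_square_refine:
  assumes fin: "finite \<Omega>"
    and refine: "\<And>x y. x \<in> \<Omega> \<Longrightarrow> y \<in> \<Omega> \<Longrightarrow> l' x = l' y \<Longrightarrow> l x = l y"
  shows "(\<Sum>x\<in>\<Omega>. (fiber_avg \<Omega> l' g x)\<^sup>2) =
    (\<Sum>x\<in>\<Omega>. (fiber_avg \<Omega> l g x)\<^sup>2) + (\<Sum>x\<in>\<Omega>. (fiber_avg \<Omega> l' g x - fiber_avg \<Omega> l g x)\<^sup>2)"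
proof -
  let ?p = "fiber_avg \<Omega> l g" and ?q = "fiber_avg \<Omega> l' g"
  have "(\<Sum>x\<in>\<Omega>. ?p x * ?q x) = (\<Sum>x\<in>\<Omega>. ?p x * g x)"
    by (intro sum_mult_fiber_avg fin) (metis refine fiber_avg_cong)
  also have "\<dots> = (\<Sum>x\<in>\<Omega>. ?p x * ?p x)"
    by (intro sum_mult_fiber_avg[symmetric] fin) (metis fiber_avg_cong)
  finally have orthogonal: "(\<Sum>x\<in>\<Omega>. ?p x * ?q x) = (\<Sum>x\<in>\<Omega>. ?p x * ?p x)" .
  have "(\<Sum>x\<in>\<Omega>. (?q x - ?p x)\<^sup>2)
      = (\<Sum>x\<in>\<Omega>. (?q x)\<^sup>2) + (\<Sum>x\<in>\<Omega>. ?p x * ?p x) - 2 * (\<Sum>x\<in>\<Omega>. ?p x * ?q x)"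
    by (simp add: power2_eq_square algebra_simps sum.distrib sum_subtractf sum_distrib_left)
  then show ?thesis using orthogonal by (simp add: power2_eq_square)
qed

section \<open>Szemeredi's regularity lemma\<close>

definition density :: "('a \<times> 'b) set \<Rightarrow> 'a set \<Rightarrow> 'b set \<Rightarrow> real" where
  "density R A B = card (R \<inter> A \<times> B) / (card A * card B)"

definition irregularity_witness ::
  "('a \<times> 'b) set \<Rightarrow> real \<Rightarrow> 'a set \<Rightarrow> 'b set \<Rightarrow> 'a set \<Rightarrow> 'b set \<Rightarrow> bool" where
  "irregularity_witness R \<epsilon> A B X Y \<longleftrightarrow> X \<subseteq> A \<and> Y \<subseteq> B \<and>
     \<epsilon> * card A \<le> card X \<and> \<epsilon> * card B \<le> card Y \<and> \<epsilon> < \<bar>density R X Y - density R A B\<bar>"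

definition regular_pair :: "('a \<times> 'b) set \<Rightarrow> real \<Rightarrow> 'a set \<Rightarrow> 'b set \<Rightarrow> bool" where
  "regular_pair R \<epsilon> A B \<longleftrightarrow> \<not> (\<exists>X Y. irregularity_witness R \<epsilon> A B X Y)"

definition irregular_pairs :: "('a \<times> 'a) set \<Rightarrow> real \<Rightarrow> 'a set set \<Rightarrow> ('a set \<times> 'a set) set" where
  "irregular_pairs R \<epsilon> P = {(A, B) \<in> P \<times> P. \<not> regular_pair R \<epsilon> A B}"

text \<open>The parts need not have equal size, hence the irregular pairs are weighted by their size.\<close>

definition regular_partition :: "('a \<times> 'a) set \<Rightarrow> real \<Rightarrow> 'a set \<Rightarrow> 'a set set \<Rightarrow> bool" where
  "regular_partition R \<epsilon> V P \<longleftrightarrow> partition_on V P \<and>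
     (\<Sum>(A, B)\<in>irregular_pairs R \<epsilon> P. card A * card B) \<le> \<epsilon> * (real (card V))\<^sup>2"

lemma card_Int_Times_eq_density:
  assumes "finite A" "finite B"
  shows "card (R \<inter> A \<times> B) = density R A B * (card A * card B)"
proof (cases "card A * card B = 0")
  case True
  then have "R \<inter> A \<times> B = {}" using assms by auto
  then show ?thesis by (simp add: density_def)
qed (simp add: density_def)

definition part :: "'a set set \<Rightarrow> 'a \<Rightarrow> 'a set" where
  "part P x = \<Union>{A \<in> P. x \<in> A}"

lemma part_eq:
  assumes "partition_on V P" "A \<in> P" "x \<in> A"
  shows "part P x = A"
proof -
  have "{B \<in> P. x \<in> B} = {A}"
    using assms partition_onD2[OF assms(1)] by (auto dest: disjointD)
  then show ?thesis by (simp add: part_def)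
qed

lemma part_mem:
  assumes "partition_on V P" "x \<in> V"
  shows "part P x \<in> P" "x \<in> part P x"
proof -
  obtain A where "A \<in> P" "x \<in> A" using assms by (auto simp: partition_on_def)
  then show "part P x \<in> P" "x \<in> part P x" using part_eq[OF assms(1)] by simp_all
qed

lemma part_eq_iff:
  assumes "partition_on V P" "A \<in> P"
  shows "x \<in> V \<and> part P x = A \<longleftrightarrow> x \<in> A"
  using part_eq[OF assms] part_mem(2)[OF assms(1)] assms by (auto simp: partition_on_def)

lemma part_eq_refines:
  assumes "refines V P' P" "x \<in> V" "y \<in> V" "part P' x = part P' y"
  shows "part P x = part P y"
proof -
  have P: "partition_on V P'" "partition_on V P" using assms(1) by (simp_all add: refines_def)
  obtain B where B: "B \<in> P" "part P' x \<subseteq> B"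
    using assms(1) part_mem(1)[OF P(1) assms(2)] by (auto simp: refines_def)
  then have "x \<in> B" "y \<in> B"
    using part_mem(2)[OF P(1) assms(2)] part_mem(2)[OF P(1) assms(3)] assms(4) by auto
  then show ?thesis using part_eq[OF P(2) B(1)] by simp
qed

lemma sum_partition_Times:
  assumes "finite V" "partition_on V P" "finite W" "partition_on W Q"
  shows "(\<Sum>(A, B)\<in>P \<times> Q. sum f (A \<times> B)) = sum f (V \<times> W)"
proof -
  have "(\<Sum>(A, B)\<in>P \<times> Q. sum f (A \<times> B)) = (\<Sum>A\<in>P. \<Sum>B\<in>Q. \<Sum>x\<in>A. \<Sum>y\<in>B. f (x, y))"
    by (simp add: sum.cartesian_product case_prod_unfold)
  also have "\<dots> = (\<Sum>A\<in>P. \<Sum>x\<in>A. \<Sum>B\<in>Q. \<Sum>y\<in>B. f (x, y))"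
    by (intro sum.cong refl sum.swap)
  also have "\<dots> = (\<Sum>x\<in>V. \<Sum>y\<in>W. f (x, y))"
    using assms by (simp add: sum.partition[of V P] sum.partition[of W Q])
  finally show ?thesis by (simp add: sum.cartesian_product)
qed

definition splits :: "'a set set \<Rightarrow> 'a set \<Rightarrow> bool" where
  "splits P X \<longleftrightarrow> (\<forall>C\<in>P. C \<subseteq> X \<or> C \<inter> X = {})"

lemma splits_refines:
  assumes "splits Q X" "refines V P Q"
  shows "splits P X"
  unfolding splits_def
proof
  fix C assume "C \<in> P"
  then obtain D where "D \<in> Q" "C \<subseteq> D" using assms(2) by (auto simp: refines_def)
  then show "C \<subseteq> X \<or> C \<inter> X = {}" using assms(1) by (auto simp: splits_def)
qed

lemma mem_iff_if_splits:
  assumes "partition_on V P" "splits P X" "x \<in> V" "y \<in> V" "part P x = part P y"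
  shows "x \<in> X \<longleftrightarrow> y \<in> X"
proof -
  have "part P x \<in> P" "x \<in> part P x" "y \<in> part P x"
    using part_mem[OF assms(1,3)] part_mem(2)[OF assms(1,4)] assms(5) by simp_all
  then show ?thesis using assms(2) by (auto simp: splits_def)
qed

lemma exists_refinement_splitting_set:
  assumes fin: "finite V" and P: "partition_on V P" and X: "X \<subseteq> V"
  shows "\<exists>P'. refines V P' P \<and> card P' \<le> card P * 2 \<and> splits P' X"
proof -
  define S where "S = {X, V - X} - {{}}"
  have S: "partition_on V S" "finite S" using X by (auto simp: S_def partition_on_def disjoint_def)
  have "card S \<le> card {X, V - X}" unfolding S_def by (intro card_mono) auto
  then have card_S: "card S \<le> 2" by (simp add: card_insert_if split: if_splits)
  let ?P' = "common_refinement {P, S}"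
  have "card ?P' \<le> (\<Prod>Q\<in>{P, S}. card Q)"
    using S(2) finite_elements[OF fin P] by (intro card_common_refinement) auto
  also have "\<dots> \<le> card P * 2" using card_S by (cases "P = S") simp_all
  finally have "card ?P' \<le> card P * 2" .
  moreover have refines: "refines V ?P' P" "refines V ?P' S"
    using P S(1) by (auto intro!: refines_common_refinement)
  moreover have "splits S X" by (auto simp: splits_def S_def)
  then have "splits ?P' X" using refines(2) by (rule splits_refines)
  ultimately show ?thesis by blast
qed

lemma exists_refinement_splitting:
  assumes fin: "finite V" and P: "partition_on V P"
    and "finite \<X>" "\<And>X. X \<in> \<X> \<Longrightarrow> X \<subseteq> V"
  shows "\<exists>P'. refines V P' P \<and> card P' \<le> card P * 2 ^ card \<X> \<and> (\<forall>X\<in>\<X>. splits P' X)"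
  using assms(3,4)
proof (induction \<X>)
  case empty
  then show ?case using refines_refl[OF P] by (intro exI[of _ P]) simp
next
  case (insert X \<X>)
  then obtain Q where Q: "refines V Q P" "card Q \<le> card P * 2 ^ card \<X>" "\<forall>Y\<in>\<X>. splits Q Y"
    by blast
  have "partition_on V Q" using Q(1) by (simp add: refines_def)
  then obtain P' where P': "refines V P' Q" "card P' \<le> card Q * 2" "splits P' X"
    using exists_refinement_splitting_set[OF fin, of Q X] insert.prems by blast
  have "refines V P' P" using P'(1) Q(1) by (rule refines_trans)
  moreover have "card P' \<le> card P * 2 ^ card (insert X \<X>)"
    using P'(2) Q(2) insert.hyps by simp
  moreover have "\<forall>Y\<in>insert X \<X>. splits P' Y" using P'(3) Q(3) splits_refines[OF _ P'(1)] by blast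
  ultimately show ?case by blast
qed

definition step_density :: "('a \<times> 'a) set \<Rightarrow> 'a set \<Rightarrow> 'a set set \<Rightarrow> 'a \<times> 'a \<Rightarrow> real" where
  "step_density R V P = fiber_avg (V \<times> V) (map_prod (part P) (part P)) (indicator R)"

definition energy :: "('a \<times> 'a) set \<Rightarrow> 'a set \<Rightarrow> 'a set set \<Rightarrow> real" where
  "energy R V P = (\<Sum>p\<in>V \<times> V. (step_density R V P p)\<^sup>2)"

lemma step_density_eq_density:
  assumes fin: "finite V" and P: "partition_on V P"
    and AB: "A \<in> P" "B \<in> P" and p: "p \<in> A \<times> B"
  shows "step_density R V P p = density R A B"
proof -
  obtain x y where xy: "p = (x, y)" "part P x = A" "part P y = B"
    using p part_eq[OF P AB(1)] part_eq[OF P AB(2)] by blast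
  have "(u, v) \<in> V \<times> V \<and> map_prod (part P) (part P) (u, v) = map_prod (part P) (part P) p
      \<longleftrightarrow> (u, v) \<in> A \<times> B" for u v
    unfolding xy(1) map_prod_simp xy(2,3) mem_Sigma_iff prod.inject
    using part_eq_iff[OF P AB(1), of u] part_eq_iff[OF P AB(2), of v] by blast
  then have fiber: "{q \<in> V \<times> V. map_prod (part P) (part P) q = map_prod (part P) (part P) p}
      = A \<times> B"
    unfolding set_eq_iff mem_Collect_eq split_paired_All by blast
  have "finite (A \<times> B)"
    using fin P AB by (metis finite_cartesian_product finite_subset Union_upper partition_onD1)
  then have "(\<Sum>q\<in>A \<times> B. indicator R q) = real (card (R \<inter> A \<times> B))"
    by (simp add: sum_indicator_eq_card Int_commute flip: real_of_nat_indicator of_nat_sum)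
  then show ?thesis
    by (simp add: step_density_def fiber_avg_def fiber density_def card_cartesian_product)
qed

lemma energy_nonneg: "0 \<le> energy R V P"
  by (simp add: energy_def sum_nonneg)

lemma energy_le: "energy R V P \<le> (real (card V))\<^sup>2"
proof -
  have "(step_density R V P p)\<^sup>2 \<le> 1" for p
    unfolding step_density_def
    by (intro power_le_one fiber_avg_nonneg fiber_avg_le_one) (auto simp: indicator_def)
  then have "energy R V P \<le> (\<Sum>p\<in>V \<times> V. 1)"
    unfolding energy_def by (intro sum_mono)
  then show ?thesis by (simp add: card_cartesian_product power2_eq_square)
qed

lemma energy_refines:
  assumes "finite V" "refines V P' P"
  shows "energy R V P'
    = energy R V P + (\<Sum>p\<in>V \<times> V. (step_density R V P' p - step_density R V P p)\<^sup>2)"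
  unfolding energy_def step_density_def
proof (rule sum_fiber_avg_square_refine)
  fix p q
  assume pq: "p \<in> V \<times> V" "q \<in> V \<times> V"
    "map_prod (part P') (part P') p = map_prod (part P') (part P') q"
  obtain x y x' y' where "p = (x, y)" "q = (x', y')" by fastforce
  then show "map_prod (part P) (part P) p = map_prod (part P) (part P) q"
    using pq part_eq_refines[OF assms(2), of x x'] part_eq_refines[OF assms(2), of y y'] by simp
qed (use assms(1) in simp)

lemma sum_step_density_Times:
  assumes fin: "finite V" and P: "partition_on V P"
    and XY: "X \<subseteq> V" "Y \<subseteq> V" "splits P X" "splits P Y"
  shows "(\<Sum>p\<in>X \<times> Y. step_density R V P p) = density R X Y * (card X * card Y)"
proof -
  have finite: "finite X" "finite Y" using fin XY(1,2) finite_subset by auto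
  have "(\<Sum>p\<in>X \<times> Y. step_density R V P p) = (\<Sum>p\<in>X \<times> Y. indicator R p)"
    unfolding step_density_def
  proof (rule sum_fiber_avg_saturated)
    fix p q
    assume p: "p \<in> X \<times> Y" and q: "q \<in> V \<times> V"
      and eq: "map_prod (part P) (part P) p = map_prod (part P) (part P) q"
    obtain x y x' y' where "p = (x, y)" "q = (x', y')" by fastforce
    then show "q \<in> X \<times> Y"
      using p q eq XY(1,2)
        mem_iff_if_splits[OF P XY(3), of x x'] mem_iff_if_splits[OF P XY(4), of y y']
      by auto
  qed (use fin XY(1,2) in auto)
  also have "\<dots> = card (R \<inter> X \<times> Y)"
    using finite
    by (simp add: sum_indicator_eq_card Int_commute flip: real_of_nat_indicator of_nat_sum)
  also have "\<dots> = density R X Y * (card X * card Y)"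
    using finite by (rule card_Int_Times_eq_density)
  finally show ?thesis .
qed

lemma step_density_deviation:
  assumes fin: "finite V" and P: "partition_on V P" "partition_on V P'"
    and AB: "A \<in> P" "B \<in> P" and XY: "X \<subseteq> A" "Y \<subseteq> B" and splits: "splits P' X" "splits P' Y"
  shows "(density R X Y - density R A B)\<^sup>2 * (card X * card Y)
    \<le> (\<Sum>p\<in>A \<times> B. (step_density R V P' p - step_density R V P p)\<^sup>2)"
proof -
  let ?D = "\<lambda>p. step_density R V P' p - step_density R V P p"
  let ?d = "density R X Y - density R A B" and ?N = "real (card X * card Y)"
  have sub: "A \<subseteq> V" "B \<subseteq> V" "X \<subseteq> V" "Y \<subseteq> V" using P AB XY by (auto simp: partition_on_def)
  have "(\<Sum>p\<in>X \<times> Y. step_density R V P p) = (\<Sum>p\<in>X \<times> Y. density R A B)"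
    using XY by (intro sum.cong refl step_density_eq_density[OF fin P(1) AB]) blast
  then have "(\<Sum>p\<in>X \<times> Y. ?D p) = ?d * ?N"
    using sum_step_density_Times[OF fin P(2) sub(3,4) splits]
    by (simp add: sum_subtractf card_cartesian_product left_diff_distrib)
  then have "(?d * ?N)\<^sup>2 \<le> (\<Sum>p\<in>X \<times> Y. (?D p)\<^sup>2) * ?N"
    using sum_squared_le_sum_of_squares[of ?D "X \<times> Y"] by (simp add: card_cartesian_product)
  then have scaled: "?d\<^sup>2 * ?N * ?N \<le> (\<Sum>p\<in>X \<times> Y. (?D p)\<^sup>2) * ?N"
    by (simp only: power2_eq_square mult_ac)
  have "?d\<^sup>2 * ?N \<le> (\<Sum>p\<in>X \<times> Y. (?D p)\<^sup>2)"
  proof (cases "?N = 0")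
    case True
    show ?thesis unfolding True by (simp add: sum_nonneg)
  next
    case False
    then have "0 < ?N" by simp
    with scaled show ?thesis by (rule mult_right_le_imp_le)
  qed
  also have "\<dots> \<le> (\<Sum>p\<in>A \<times> B. (?D p)\<^sup>2)"
    using XY sub fin by (intro sum_mono2) (auto intro: finite_subset)
  finally show ?thesis .
qed

definition refined_card :: "nat \<Rightarrow> nat" where
  "refined_card k = k * 2 ^ (2 * k\<^sup>2)"

lemma mono_refined_card: "mono refined_card"
  unfolding refined_card_def
  by (intro monoI mult_mono power_increasing power_mono mult_left_mono) auto

lemma exists_refinement_splitting_witnesses:
  assumes fin: "finite V" and P: "partition_on V P"
  shows "\<exists>P'. refines V P' P \<and> card P' \<le> refined_card (card P) \<and>
    (\<forall>(A, B)\<in>irregular_pairs R \<epsilon> P.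
      \<exists>X Y. irregularity_witness R \<epsilon> A B X Y \<and> splits P' X \<and> splits P' Y)"
proof -
  let ?I = "irregular_pairs R \<epsilon> P"
  have "\<forall>A B. \<exists>X Y. (A, B) \<in> ?I \<longrightarrow> irregularity_witness R \<epsilon> A B X Y"
    by (auto simp: irregular_pairs_def regular_pair_def)
  then obtain X Y where witness: "\<And>A B. (A, B) \<in> ?I \<Longrightarrow> irregularity_witness R \<epsilon> A B (X A B) (Y A B)"
    by metis
  define \<X> where "\<X> = case_prod X ` ?I \<union> case_prod Y ` ?I"
  have I: "?I \<subseteq> P \<times> P" by (auto simp: irregular_pairs_def)
  then have finI: "finite ?I" using finite_elements[OF fin P] finite_subset by blast
  have "card \<X> \<le> card ?I + card ?I"
    unfolding \<X>_def using finI by (meson add_mono card_Un_le card_image_le le_trans)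
  also have "card ?I \<le> (card P)\<^sup>2"
    using card_mono[OF _ I] finite_elements[OF fin P]
    by (simp add: card_cartesian_product power2_eq_square)
  finally have card_\<X>: "card \<X> \<le> 2 * (card P)\<^sup>2" by simp
  have "S \<subseteq> V" if S: "S \<in> \<X>" for S
  proof -
    obtain A B where AB: "(A, B) \<in> ?I" "S = X A B \<or> S = Y A B" using S by (auto simp: \<X>_def)
    then have "S \<subseteq> A \<union> B" using witness[OF AB(1)] by (auto simp: irregularity_witness_def)
    then show ?thesis using AB(1) I partition_onD1[OF P] by blast
  qed
  then obtain P' where refines: "refines V P' P" and card: "card P' \<le> card P * 2 ^ card \<X>"
    and splits: "\<And>S. S \<in> \<X> \<Longrightarrow> splits P' S"
    using exists_refinement_splitting[OF fin P, of \<X>] finI by (auto simp: \<X>_def)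
  have "card P' \<le> refined_card (card P)"
    unfolding refined_card_def using card card_\<X>
    by (meson le_trans mult_le_mono2 one_le_numeral power_increasing)
  moreover have "X A B \<in> \<X>" "Y A B \<in> \<X>" if "(A, B) \<in> ?I" for A B
    using imageI[OF that, of "case_prod X"] imageI[OF that, of "case_prod Y"] by (auto simp: \<X>_def)
  then have "splits P' (X A B)" "splits P' (Y A B)" if "(A, B) \<in> ?I" for A B
    using splits that by blast+
  ultimately show ?thesis using refines witness by blast
qed

lemma energy_increment:
  assumes fin: "finite V" and P: "partition_on V P" and \<epsilon>: "0 < \<epsilon>"
  shows "\<exists>P'. partition_on V P' \<and> card P' \<le> refined_card (card P) \<and>
    energy R V P + \<epsilon> ^ 4 * (\<Sum>(A, B)\<in>irregular_pairs R \<epsilon> P. card A * card B) \<le> energy R V P'"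
proof -
  let ?I = "irregular_pairs R \<epsilon> P"
  obtain P' where refines: "refines V P' P" and card: "card P' \<le> refined_card (card P)"
    and split: "\<And>A B. (A, B) \<in> ?I \<Longrightarrow>
      \<exists>X Y. irregularity_witness R \<epsilon> A B X Y \<and> splits P' X \<and> splits P' Y"
    using exists_refinement_splitting_witnesses[OF fin P, of R \<epsilon>] by blast
  have P': "partition_on V P'" using refines by (simp add: refines_def)
  let ?D = "\<lambda>p. (step_density R V P' p - step_density R V P p)\<^sup>2"
  have gain: "\<epsilon> ^ 4 * (card A * card B) \<le> sum ?D (A \<times> B)" if AB: "(A, B) \<in> ?I" for A B
  proof -
    obtain X Y where witness: "irregularity_witness R \<epsilon> A B X Y" and XY: "splits P' X" "splits P' Y"
      using split[OF AB] by blast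
    have "\<epsilon> ^ 4 * (card A * card B) = \<epsilon>\<^sup>2 * ((\<epsilon> * card A) * (\<epsilon> * card B))"
      by (simp add: power2_eq_square power4_eq_xxxx)
    also have "\<dots> \<le> (density R X Y - density R A B)\<^sup>2 * (card X * card Y)"
      using witness \<epsilon> unfolding irregularity_witness_def
      by (intro mult_mono) (auto simp: abs_le_square_iff[symmetric] intro: mult_mono)
    also have "\<dots> \<le> sum ?D (A \<times> B)"
      using witness AB by (intro step_density_deviation[OF fin P P'] XY)
        (auto simp: irregularity_witness_def irregular_pairs_def)
    finally show ?thesis .
  qed
  have "\<epsilon> ^ 4 * (\<Sum>(A, B)\<in>?I. card A * card B) = (\<Sum>(A, B)\<in>?I. \<epsilon> ^ 4 * (card A * card B))"
    by (simp add: sum_distrib_left case_prod_unfold)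
  also have "\<dots> \<le> (\<Sum>(A, B)\<in>?I. sum ?D (A \<times> B))" using gain by (intro sum_mono) auto
  also have "\<dots> \<le> (\<Sum>(A, B)\<in>P \<times> P. sum ?D (A \<times> B))"
    using finite_elements[OF fin P] by (intro sum_mono2) (auto simp: sum_nonneg irregular_pairs_def)
  also have "\<dots> = sum ?D (V \<times> V)" by (rule sum_partition_Times[OF fin P fin P])
  finally show ?thesis using energy_refines[OF fin refines] card P' by (intro exI[of _ P']) simp
qed

lemma energy_iterate:
  assumes fin: "finite V" and \<epsilon>: "0 < \<epsilon>"
  shows "\<exists>P. partition_on V P \<and> card P \<le> (refined_card ^^ j) 1 \<and>
    (regular_partition R \<epsilon> V P \<or> j * \<epsilon> ^ 5 * (real (card V))\<^sup>2 \<le> energy R V P)"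
proof (induction j)
  case 0
  have "partition_on V ({V} - {{}})" "card ({V} - {{}}) \<le> 1"
    by (auto simp: partition_on_def insert_Diff_if)
  then show ?case by (intro exI[of _ "{V} - {{}}"]) (simp add: energy_nonneg)
next
  case (Suc j)
  then obtain P where P: "partition_on V P" "card P \<le> (refined_card ^^ j) 1"
    "regular_partition R \<epsilon> V P \<or> j * \<epsilon> ^ 5 * (real (card V))\<^sup>2 \<le> energy R V P" by blast
  have bound: "refined_card (card P) \<le> (refined_card ^^ Suc j) 1"
    using P(2) by (simp add: monoD[OF mono_refined_card])
  show ?case
  proof (cases "regular_partition R \<epsilon> V P")
    case True
    have "card P \<le> refined_card (card P)" by (simp add: refined_card_def)
    then show ?thesis using True P(1) bound le_trans by blast
  next
    case False
    let ?irr = "\<Sum>(A, B)\<in>irregular_pairs R \<epsilon> P. card A * card B"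
    obtain P' where P': "partition_on V P'" "card P' \<le> refined_card (card P)"
      "energy R V P + \<epsilon> ^ 4 * ?irr \<le> energy R V P'"
      using energy_increment[OF fin P(1) \<epsilon>] by blast
    have "\<epsilon> ^ 5 * (real (card V))\<^sup>2 = \<epsilon> ^ 4 * (\<epsilon> * (real (card V))\<^sup>2)"
      by (simp add: numeral_eq_Suc)
    also have "\<dots> \<le> \<epsilon> ^ 4 * ?irr"
      using False P(1) \<epsilon> by (intro mult_left_mono) (auto simp: regular_partition_def)
    finally have "Suc j * \<epsilon> ^ 5 * (real (card V))\<^sup>2 \<le> energy R V P'"
      using P'(3) P(3) False by (simp add: distrib_right)
    then show ?thesis using P'(1,2) bound le_trans by blast
  qed
qed

theorem regularity_lemma:
  assumes \<epsilon>: "0 < (\<epsilon>::real)"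
  shows "\<exists>M. \<forall>(V :: 'a set) R. finite V \<longrightarrow> (\<exists>P. card P \<le> M \<and> regular_partition R \<epsilon> V P)"
proof -
  obtain k :: nat where k_large: "1 < k * \<epsilon> ^ 5" using \<epsilon> reals_Archimedean3[of "\<epsilon> ^ 5"] by auto
  have "\<exists>P. card P \<le> (refined_card ^^ k) 1 \<and> regular_partition R \<epsilon> V P"
    if fin: "finite V" for V :: "'a set" and R
  proof -
    let ?n2 = "(real (card V))\<^sup>2"
    obtain P where P: "partition_on V P" "card P \<le> (refined_card ^^ k) 1"
      "regular_partition R \<epsilon> V P \<or> k * \<epsilon> ^ 5 * ?n2 \<le> energy R V P"
      using energy_iterate[OF fin \<epsilon>] by blast
    have "regular_partition R \<epsilon> V P"
    proof (cases "V = {}")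
      case True
      then have "irregular_pairs R \<epsilon> P = {}"
        using P(1) by (auto simp: partition_on_def irregular_pairs_def)
      then show ?thesis using P(1) True by (simp add: regular_partition_def)
    next
      case False
      then have "1 * ?n2 < k * \<epsilon> ^ 5 * ?n2"
        using fin k_large by (intro mult_strict_right_mono) auto
      then show ?thesis using P(3) energy_le[of R V P] by linarith
    qed
    then show ?thesis using P(2) by blast
  qed
  then show ?thesis by blast
qed

section \<open>The triangle removal lemma\<close>

lemma card_Int_Times_eq_sum:
  assumes "finite A" "finite B"
  shows "card (R \<inter> A \<times> B) = (\<Sum>a\<in>A. card (R `` {a} \<inter> B))"
proof -
  have "R \<inter> A \<times> B = (SIGMA a:A. R `` {a} \<inter> B)" by auto
  then show ?thesis using assms by simp
qed

lemma regular_pair_card_ge: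
  fixes \<epsilon> :: real
  assumes "finite A" "finite B" "regular_pair R \<epsilon> A B"
    and "X \<subseteq> A" "Y \<subseteq> B" "\<epsilon> * card A \<le> card X" "\<epsilon> * card B \<le> card Y"
  shows "(density R A B - \<epsilon>) * (card X * card Y) \<le> card (R \<inter> X \<times> Y)"
proof -
  have "finite X" "finite Y" using assms finite_subset by auto
  then have "card (R \<inter> X \<times> Y) = density R X Y * (card X * card Y)"
    by (rule card_Int_Times_eq_density)
  moreover have "\<bar>density R X Y - density R A B\<bar> \<le> \<epsilon>"
    using assms(3-7) unfolding regular_pair_def irregularity_witness_def by (meson not_le)
  then have "density R A B - \<epsilon> \<le> density R X Y" by linarith
  ultimately show ?thesis by (simp add: mult_right_mono)
qed

lemma card_low_degree_less:
  fixes \<epsilon> :: real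
  assumes fin: "finite A" "finite B" "A \<noteq> {}" "B \<noteq> {}" and \<epsilon>: "0 < \<epsilon>" "\<epsilon> \<le> 1"
    and reg: "regular_pair R \<epsilon> A B" and dens: "2 * \<epsilon> \<le> density R A B"
  shows "card {a \<in> A. card (R `` {a} \<inter> B) < \<epsilon> * card B} < \<epsilon> * card A"
proof (rule ccontr)
  define X where "X = {a \<in> A. card (R `` {a} \<inter> B) < \<epsilon> * card B}"
  assume "\<not> ?thesis"
  then have large: "\<epsilon> * card A \<le> card X" by (simp add: X_def)
  have X: "X \<subseteq> A" "finite X" using fin by (auto simp: X_def)
  have "0 < \<epsilon> * card A" using fin \<epsilon> by (simp add: card_gt_0_iff)
  then have "X \<noteq> {}" using large by auto
  have "\<epsilon> * card B \<le> card B" using \<epsilon> by (simp add: mult_left_le_one_le)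
  have "\<epsilon> * (card X * card B) \<le> (density R A B - \<epsilon>) * (card X * card B)"
    using dens by (intro mult_right_mono) auto
  also have "\<dots> \<le> card (R \<inter> X \<times> B)"
    using regular_pair_card_ge[OF fin(1,2) reg X(1) subset_refl large] \<open>\<epsilon> * card B \<le> card B\<close> .
  also have "\<dots> = (\<Sum>a\<in>X. real (card (R `` {a} \<inter> B)))"
    using X(2) fin(2) by (simp add: card_Int_Times_eq_sum)
  also have "\<dots> < (\<Sum>a\<in>X. \<epsilon> * card B)"
    using \<open>X \<noteq> {}\<close> X(2) by (intro sum_strict_mono) (auto simp: X_def)
  finally show False by simp
qed

lemma card_edges_between_neighbourhoods_ge:
  fixes \<epsilon> :: real
  assumes fin: "finite B" "finite C" and \<epsilon>: "0 < \<epsilon>"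
    and reg: "regular_pair R \<epsilon> B C" and dens: "2 * \<epsilon> \<le> density R B C"
    and deg: "\<epsilon> * card B \<le> card (R `` {a} \<inter> B)" "\<epsilon> * card C \<le> card (R `` {a} \<inter> C)"
  shows "\<epsilon> ^ 3 * (card B * card C) \<le> card (R \<inter> (R `` {a} \<inter> B) \<times> (R `` {a} \<inter> C))"
proof -
  let ?b = "card (R `` {a} \<inter> B)" and ?c = "card (R `` {a} \<inter> C)"
  have "\<epsilon> ^ 3 * (card B * card C) = \<epsilon> * ((\<epsilon> * card B) * (\<epsilon> * card C))"
    by (simp add: power3_eq_cube)
  also have "\<dots> \<le> \<epsilon> * (real ?b * real ?c)"
    using deg \<epsilon> by (intro mult_left_mono mult_mono) auto
  also have "\<dots> \<le> (density R B C - \<epsilon>) * (?b * ?c)"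
    using dens by (simp add: mult_right_mono)
  also have "\<dots> \<le> card (R \<inter> (R `` {a} \<inter> B) \<times> (R `` {a} \<inter> C))"
    using regular_pair_card_ge[OF fin reg _ _ deg] by simp
  finally show ?thesis .
qed

definition triangle_triples :: "('a \<times> 'a) set \<Rightarrow> 'a set \<Rightarrow> 'a set \<Rightarrow> 'a set \<Rightarrow> ('a \<times> 'a \<times> 'a) set" where
  "triangle_triples R A B C = {(a, b, c) \<in> A \<times> B \<times> C. (a, b) \<in> R \<and> (a, c) \<in> R \<and> (b, c) \<in> R}"

lemma triangle_triples_mono:
  "A \<subseteq> A' \<Longrightarrow> B \<subseteq> B' \<Longrightarrow> C \<subseteq> C' \<Longrightarrow> triangle_triples R A B C \<subseteq> triangle_triples R A' B' C'"
  by (auto simp: triangle_triples_def)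

lemma finite_triangle_triples:
  "finite A \<Longrightarrow> finite B \<Longrightarrow> finite C \<Longrightarrow> finite (triangle_triples R A B C)"
  by (rule finite_subset[of _ "A \<times> B \<times> C"]) (auto simp: triangle_triples_def)

lemma card_triangle_triples:
  assumes "finite A" "finite B" "finite C"
  shows "card (triangle_triples R A B C) = (\<Sum>a\<in>A. card (R \<inter> (R `` {a} \<inter> B) \<times> (R `` {a} \<inter> C)))"
proof -
  have "triangle_triples R A B C = (SIGMA a:A. R \<inter> (R `` {a} \<inter> B) \<times> (R `` {a} \<inter> C))"
    by (auto simp: triangle_triples_def)
  then show ?thesis using assms by simp
qed

lemma triangle_counting:
  fixes \<epsilon> :: real
  assumes fin: "finite A" "finite B" "finite C" and ne: "A \<noteq> {}" "B \<noteq> {}" "C \<noteq> {}"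
    and \<epsilon>: "0 < \<epsilon>" "\<epsilon> \<le> 1/4"
    and reg: "regular_pair R \<epsilon> A B" "regular_pair R \<epsilon> A C" "regular_pair R \<epsilon> B C"
    and dens: "2 * \<epsilon> \<le> density R A B" "2 * \<epsilon> \<le> density R A C" "2 * \<epsilon> \<le> density R B C"
  shows "\<epsilon> ^ 3 / 2 * (real (card A) * card B * card C) \<le> card (triangle_triples R A B C)"
proof -
  define low where "low D = {a \<in> A. card (R `` {a} \<inter> D) < \<epsilon> * card D}" for D
  define Z where "Z = A - (low B \<union> low C)"
  have "card (low B) < \<epsilon> * card A" "card (low C) < \<epsilon> * card A"
    unfolding low_def using \<epsilon> by (intro card_low_degree_less fin ne reg dens; simp)+
  moreover have "\<epsilon> * card A \<le> 1/4 * card A" using \<epsilon> by (intro mult_right_mono) auto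
  moreover have "card A \<le> card Z + (card (low B) + card (low C))"
  proof -
    have "A = Z \<union> (low B \<union> low C)" by (auto simp: Z_def low_def)
    then show ?thesis by (metis card_Un_le le_trans add_left_mono)
  qed
  ultimately have half: "card A / 2 \<le> card Z" by linarith
  let ?link = "\<lambda>a. card (R \<inter> (R `` {a} \<inter> B) \<times> (R `` {a} \<inter> C))"
  have link: "\<epsilon> ^ 3 * (card B * card C) \<le> ?link a" if "a \<in> Z" for a
    using that by (intro card_edges_between_neighbourhoods_ge fin \<epsilon> reg dens)
      (auto simp: Z_def low_def)
  have "\<epsilon> ^ 3 / 2 * (real (card A) * card B * card C) = (card A / 2) * (\<epsilon> ^ 3 * (card B * card C))"
    by simp
  also have "\<dots> \<le> card Z * (\<epsilon> ^ 3 * (card B * card C))"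
    using half \<epsilon> by (intro mult_right_mono) auto
  also have "\<dots> = (\<Sum>a\<in>Z. \<epsilon> ^ 3 * (card B * card C))" by simp
  also have "\<dots> \<le> (\<Sum>a\<in>Z. real (?link a))" using link by (intro sum_mono) auto
  also have "\<dots> \<le> (\<Sum>a\<in>A. real (?link a))" using fin by (intro sum_mono2) (auto simp: Z_def)
  also have "\<dots> = card (triangle_triples R A B C)"
    by (simp add: card_triangle_triples[OF fin])
  finally show ?thesis .
qed

definition exceptional_pairs :: "('a \<times> 'a) set \<Rightarrow> real \<Rightarrow> 'a set \<Rightarrow> 'a set set \<Rightarrow> ('a \<times> 'a) set" where
  "exceptional_pairs R \<epsilon> V P =
     (let small = \<Union>{A \<in> P. real (card A * card P) < \<epsilon> * card V}
      in (\<Union>(A, B)\<in>irregular_pairs R \<epsilon> P. A \<times> B) \<union>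
         (\<Union>(A, B)\<in>{(A, B) \<in> P \<times> P. density R A B < 2 * \<epsilon>}. R \<inter> A \<times> B) \<union>
         (small \<times> V \<union> V \<times> small))"

lemma exceptional_pairs_subset:
  assumes "partition_on V P"
  shows "exceptional_pairs R \<epsilon> V P \<subseteq> V \<times> V"
  using partition_onD1[OF assms] by (auto simp: exceptional_pairs_def irregular_pairs_def Let_def)

lemma card_sparse_pairs_le:
  fixes d :: real
  assumes fin: "finite V" and P: "partition_on V P" and d: "0 \<le> d"
  shows "card (\<Union>(A, B)\<in>{(A, B) \<in> P \<times> P. density R A B < d}. R \<inter> A \<times> B) \<le> d * (real (card V))\<^sup>2"
proof -
  let ?sparse = "{(A, B) \<in> P \<times> P. density R A B < d}"
  have finP: "finite P" using fin P by (rule finite_elements)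
  have parts: "finite A" if "A \<in> P" for A
    using that fin partition_onD1[OF P] by (metis Union_upper finite_subset)
  have sparse: "?sparse \<subseteq> P \<times> P" "finite ?sparse"
    using finP by (auto intro: finite_subset[of _ "P \<times> P"])
  have "card (\<Union>(A, B)\<in>?sparse. R \<inter> A \<times> B) \<le> (\<Sum>(A, B)\<in>?sparse. card (R \<inter> A \<times> B))"
    using card_UN_le[OF sparse(2), of "\<lambda>(A, B). R \<inter> A \<times> B"] by (simp add: case_prod_unfold)
  then have "real (card (\<Union>(A, B)\<in>?sparse. R \<inter> A \<times> B)) \<le> (\<Sum>(A, B)\<in>?sparse. real (card (R \<inter> A \<times> B)))"
    by (simp add: case_prod_unfold flip: of_nat_sum)
  also have "\<dots> \<le> (\<Sum>(A, B)\<in>?sparse. d * (card A * card B))"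
    using parts d by (intro sum_mono) (auto simp: card_Int_Times_eq_density intro!: mult_right_mono)
  also have "\<dots> \<le> (\<Sum>(A, B)\<in>P \<times> P. d * (card A * card B))"
    using sparse(1) finP d by (intro sum_mono2) auto
  also have "\<dots> = d * (\<Sum>(A, B)\<in>P \<times> P. \<Sum>p\<in>A \<times> B. 1)"
    by (simp add: sum_distrib_left case_prod_unfold card_cartesian_product)
  also have "\<dots> = d * (real (card V))\<^sup>2"
    unfolding sum_partition_Times[OF fin P fin P]
    by (simp add: card_cartesian_product power2_eq_square)
  finally show ?thesis .
qed

lemma card_Union_small_parts_le:
  fixes t :: real
  assumes "finite P" "0 \<le> t"
  shows "card (\<Union>{A \<in> P. real (card A * card P) < t}) \<le> t"
proof (cases "P = {}")
  case False
  let ?small = "{A \<in> P. real (card A * card P) < t}"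
  have pos: "0 < real (card P)" using False assms(1) by (simp add: card_gt_0_iff)
  have "card (\<Union>?small) \<le> (\<Sum>A\<in>?small. card A)" by (rule card_Union_le_sum_card)
  then have "real (card (\<Union>?small)) \<le> (\<Sum>A\<in>?small. real (card A))" by (simp flip: of_nat_sum)
  also have "\<dots> \<le> (\<Sum>A\<in>?small. t / card P)"
    using pos by (intro sum_mono) (simp add: pos_le_divide_eq)
  also have "\<dots> \<le> (\<Sum>A\<in>P. t / card P)" using assms by (intro sum_mono2) auto
  also have "\<dots> = t" using pos by simp
  finally show ?thesis .
qed (use assms in simp)

lemma card_exceptional_pairs_le:
  fixes \<epsilon> :: real
  assumes fin: "finite V" and reg: "regular_partition R \<epsilon> V P" and \<epsilon>: "0 \<le> \<epsilon>"
  shows "card (exceptional_pairs R \<epsilon> V P) \<le> 5 * \<epsilon> * (real (card V))\<^sup>2"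
proof -
  let ?n2 = "(real (card V))\<^sup>2" and ?I = "irregular_pairs R \<epsilon> P"
  define irr where "irr = (\<Union>(A, B)\<in>?I. A \<times> B)"
  define sparse where "sparse = (\<Union>(A, B)\<in>{(A, B) \<in> P \<times> P. density R A B < 2 * \<epsilon>}. R \<inter> A \<times> B)"
  define small where "small = \<Union>{A \<in> P. real (card A * card P) < \<epsilon> * card V}"
  have P: "partition_on V P" and finP: "finite P"
    using reg finite_elements[OF fin] by (auto simp: regular_partition_def)
  have "finite ?I" using finP by (auto simp: irregular_pairs_def intro: finite_subset[of _ "P \<times> P"])
  then have "card irr \<le> (\<Sum>(A, B)\<in>?I. card A * card B)"
    using card_UN_le[of ?I "\<lambda>(A, B). A \<times> B"]
    by (simp add: irr_def case_prod_unfold card_cartesian_product)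
  then have irr: "card irr \<le> \<epsilon> * ?n2" using reg unfolding regular_partition_def by linarith
  have sparse: "card sparse \<le> 2 * \<epsilon> * ?n2"
    unfolding sparse_def using \<epsilon> by (intro card_sparse_pairs_le fin P) simp
  have "card small \<le> \<epsilon> * card V"
    unfolding small_def using finP \<epsilon> by (intro card_Union_small_parts_le) auto
  then have small: "card (small \<times> V) \<le> \<epsilon> * ?n2" "card (V \<times> small) \<le> \<epsilon> * ?n2"
    by (simp_all add: card_cartesian_product power2_eq_square mult_right_mono
        mult.commute[of "real (card V)" "card small"] flip: mult.assoc)
  have union: "exceptional_pairs R \<epsilon> V P = (irr \<union> sparse) \<union> (small \<times> V \<union> V \<times> small)"
    by (simp add: exceptional_pairs_def irr_def sparse_def small_def Let_def)
  have "card (exceptional_pairs R \<epsilon> V P)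
      \<le> (card irr + card sparse) + (card (small \<times> V) + card (V \<times> small))"
    unfolding union by (meson add_mono card_Un_le le_trans)
  then show ?thesis using irr sparse small by linarith
qed

lemma unexceptional_pair:
  assumes P: "partition_on V P" "finite P" "card P \<le> M"
    and uv: "(u, v) \<in> R - exceptional_pairs R \<epsilon> V P" "u \<in> A" "v \<in> B" and AB: "A \<in> P" "B \<in> P"
  shows "regular_pair R \<epsilon> A B" "2 * \<epsilon> \<le> density R A B"
    "\<epsilon> * card V / M \<le> card A" "\<epsilon> * card V / M \<le> card B"
proof -
  have typical: "regular_pair R \<epsilon> A B \<and> 2 * \<epsilon> \<le> density R A B \<and>
      \<epsilon> * card V \<le> card A * card P \<and> \<epsilon> * card V \<le> card B * card P"
    using uv AB partition_onD1[OF P(1)]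
    by (auto simp: exceptional_pairs_def irregular_pairs_def Let_def not_less)
  then show "regular_pair R \<epsilon> A B" "2 * \<epsilon> \<le> density R A B" by auto
  have "0 < card P" using AB(1) P(2) by (auto simp: card_gt_0_iff)
  then have "0 < real M" using P(3) by simp
  moreover have "real (card C * card P) \<le> card C * M" for C :: "'a set"
    using P(3) by (intro of_nat_mono mult_le_mono2)
  then have "\<epsilon> * card V \<le> card A * M" "\<epsilon> * card V \<le> card B * M"
    using typical order_trans by blast+
  ultimately show "\<epsilon> * card V / M \<le> card A" "\<epsilon> * card V / M \<le> card B"
    by (simp_all add: pos_divide_le_eq)
qed

lemma card_triangle_triples_ge_unexceptional:
  fixes \<epsilon> :: real
  assumes fin: "finite V" and P: "partition_on V P" "card P \<le> M" and \<epsilon>: "0 < \<epsilon>" "\<epsilon> \<le> 1/4"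
    and xyz: "(x, y, z) \<in> triangle_triples (R - exceptional_pairs R \<epsilon> V P) V V V"
  shows "\<epsilon> ^ 3 / 2 * (\<epsilon> * card V / M) ^ 3 \<le> card (triangle_triples R V V V)"
proof -
  let ?A = "part P x" and ?B = "part P y" and ?C = "part P z"
  have "x \<in> V" "y \<in> V" "z \<in> V" using xyz by (auto simp: triangle_triples_def)
  then have parts: "?A \<in> P" "?B \<in> P" "?C \<in> P" and mem: "x \<in> ?A" "y \<in> ?B" "z \<in> ?C"
    using part_mem[OF P(1)] by simp_all
  have sub: "?A \<subseteq> V" "?B \<subseteq> V" "?C \<subseteq> V" using parts partition_onD1[OF P(1)] by auto
  then have finite: "finite ?A" "finite ?B" "finite ?C" using fin by (auto intro: finite_subset)
  have edges: "(x, y) \<in> R - exceptional_pairs R \<epsilon> V P" "(x, z) \<in> R - exceptional_pairs R \<epsilon> V P"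
    "(y, z) \<in> R - exceptional_pairs R \<epsilon> V P" using xyz by (auto simp: triangle_triples_def)
  note pair = unexceptional_pair[OF P(1) finite_elements[OF fin P(1)] P(2)]
  note xy = pair[OF edges(1) mem(1,2) parts(1,2)]
    and xz = pair[OF edges(2) mem(1,3) parts(1,3)]
    and yz = pair[OF edges(3) mem(2,3) parts(2,3)]
  have "(\<epsilon> * card V / M) ^ 3 \<le> real (card ?A) * card ?B * card ?C"
    unfolding power3_eq_cube using xy(3) yz(3,4) \<epsilon>(1) by (intro mult_mono) auto
  then have "\<epsilon> ^ 3 / 2 * (\<epsilon> * card V / M) ^ 3 \<le> \<epsilon> ^ 3 / 2 * (real (card ?A) * card ?B * card ?C)"
    using \<epsilon>(1) by (intro mult_left_mono) auto
  also have "\<dots> \<le> card (triangle_triples R ?A ?B ?C)"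
    using mem by (intro triangle_counting finite \<epsilon> xy(1,2) xz(1,2) yz(1,2)) blast+
  also have "\<dots> \<le> card (triangle_triples R V V V)"
    using sub fin by (intro of_nat_mono card_mono finite_triangle_triples triangle_triples_mono)
  finally show ?thesis .
qed

theorem triangle_removal:
  assumes "0 < (\<epsilon>::real)"
  shows "\<exists>\<delta>>0. \<forall>(V :: 'a set) R. finite V \<longrightarrow>
    card (triangle_triples R V V V) < \<delta> * real (card V) ^ 3 \<longrightarrow>
    (\<exists>D\<subseteq>V \<times> V. card D \<le> \<epsilon> * (real (card V))\<^sup>2 \<and> triangle_triples (R - D) V V V = {})"
proof -
  define e where "e = min (1/4) (\<epsilon> / 5)"
  have e: "0 < e" "e \<le> 1/4" "5 * e \<le> \<epsilon>" using assms by (auto simp: e_def)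
  obtain M where M: "\<And>(V :: 'a set) R. finite V \<Longrightarrow> \<exists>P. card P \<le> M \<and> regular_partition R e V P"
    using regularity_lemma[OF e(1), where 'a = 'a] by blast
  define \<delta> where "\<delta> = e ^ 3 / 2 * (e / Suc M) ^ 3"
  have "\<exists>D\<subseteq>V \<times> V. card D \<le> \<epsilon> * (real (card V))\<^sup>2 \<and> triangle_triples (R - D) V V V = {}"
    if fin: "finite V" and few: "card (triangle_triples R V V V) < \<delta> * real (card V) ^ 3"
    for V :: "'a set" and R
  proof -
    obtain P where P: "card P \<le> Suc M" "regular_partition R e V P" using M[OF fin] le_SucI by blast
    have partition: "partition_on V P" using P(2) by (simp add: regular_partition_def)
    let ?D = "exceptional_pairs R e V P"
    have "card (triangle_triples R V V V) < e ^ 3 / 2 * (e * card V / Suc M) ^ 3"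
      using few by (simp add: \<delta>_def power_mult_distrib power_divide)
    then have "(x, y, z) \<notin> triangle_triples (R - ?D) V V V" for x y z
      using card_triangle_triples_ge_unexceptional[OF fin partition P(1) e(1,2)] not_le by blast
    then have "triangle_triples (R - ?D) V V V = {}" by auto
    moreover have "card ?D \<le> \<epsilon> * (real (card V))\<^sup>2"
    proof -
      have "card ?D \<le> 5 * e * (real (card V))\<^sup>2"
        using card_exceptional_pairs_le[OF fin P(2)] e(1) by simp
      also have "\<dots> \<le> \<epsilon> * (real (card V))\<^sup>2" using e(3) by (rule mult_right_mono) simp
      finally show ?thesis .
    qed
    ultimately show ?thesis using exceptional_pairs_subset[OF partition] by blast
  qed
  moreover have "0 < \<delta>" using e(1) by (simp add: \<delta>_def)
  ultimately show ?thesis by blast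
qed

section \<open>Complete bipartite subgraphs of dense graphs\<close>

lemma card_le_mult_if_card_fibers_le:
  assumes "finite B" "f ` A \<subseteq> B" "\<And>b. b \<in> B \<Longrightarrow> card {a \<in> A. f a = b} \<le> k"
  shows "card A \<le> card B * k"
proof -
  have "A = (\<Union>b\<in>B. {a \<in> A. f a = b})" using assms(2) by auto
  then have "card A \<le> (\<Sum>b\<in>B. card {a \<in> A. f a = b})"
    using card_UN_le[OF assms(1), of "\<lambda>b. {a \<in> A. f a = b}"] by simp
  also have "\<dots> \<le> (\<Sum>b\<in>B. k)" using assms(3) by (rule sum_mono)
  finally show ?thesis by simp
qed

lemma card_high_degree_ge:
  fixes \<epsilon> :: real
  assumes fin: "finite A" "finite B" "B \<noteq> {}" and \<epsilon>: "0 \<le> \<epsilon>"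
    and dense: "\<epsilon> * (card A * card B) \<le> card (R \<inter> A \<times> B)"
  shows "\<epsilon> / 2 * card A \<le> card {a \<in> A. \<epsilon> / 2 * card B \<le> card (R `` {a} \<inter> B)}"
proof -
  define X where "X = {a \<in> A. \<epsilon> / 2 * card B \<le> card (R `` {a} \<inter> B)}"
  have deg: "card (R `` {a} \<inter> B) \<le> card B" for a using fin by (intro card_mono) auto
  have "\<epsilon> * (card A * card B) \<le> (\<Sum>a\<in>A. real (card (R `` {a} \<inter> B)))"
    using dense fin by (simp add: card_Int_Times_eq_sum)
  also have "\<dots> \<le> (\<Sum>a\<in>A. (if a \<in> X then real (card B) else 0) + \<epsilon> / 2 * card B)"
    using deg \<epsilon> by (intro sum_mono) (auto simp: X_def add_increasing2)
  also have "\<dots> = card X * card B + \<epsilon> / 2 * card A * card B"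
    using fin by (simp add: sum.distrib X_def flip: sum.inter_filter)
  finally have "(\<epsilon> / 2 * card A) * card B \<le> card X * real (card B)"
    by (simp add: algebra_simps)
  moreover have "0 < real (card B)" using fin by (simp add: card_gt_0_iff)
  ultimately show ?thesis unfolding X_def by (rule mult_right_le_imp_le)
qed

lemma exists_small_side_dense:
  fixes \<epsilon> :: real
  assumes fin: "finite A" "finite B" and ne: "B \<noteq> {}" and \<epsilon>: "0 \<le> \<epsilon>"
    and dense: "\<epsilon> * (card A * card B) \<le> card (R \<inter> A \<times> B)" and m: "m \<le> \<epsilon> / 2 * card A"
  shows "\<exists>M\<subseteq>A. card M = m \<and> finite M \<and> \<epsilon> / 2 * (card B * card M) \<le> card (R\<inverse> \<inter> B \<times> M)"
proof -
  define X where "X = {a \<in> A. \<epsilon> / 2 * card B \<le> card (R `` {a} \<inter> B)}"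
  have "\<epsilon> / 2 * card A \<le> card X" unfolding X_def using fin ne \<epsilon> dense by (rule card_high_degree_ge)
  then have "m \<le> card X" using m by linarith
  then obtain M where M: "M \<subseteq> X" "card M = m" "finite M" by (rule obtain_subset_with_card_n)
  have "\<epsilon> / 2 * (card B * card M) = (\<Sum>a\<in>M. \<epsilon> / 2 * card B)" by simp
  also have "\<dots> \<le> (\<Sum>a\<in>M. real (card (R `` {a} \<inter> B)))"
    using M(1) by (intro sum_mono) (auto simp: X_def)
  also have "\<dots> = card (R \<inter> M \<times> B)" using M(3) fin(2) by (simp add: card_Int_Times_eq_sum)
  also have "\<dots> = card ((R \<inter> M \<times> B)\<inverse>)" by simp
  also have "(R \<inter> M \<times> B)\<inverse> = R\<inverse> \<inter> B \<times> M" by auto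
  finally show ?thesis using M by (intro exI[of _ M]) (auto simp: X_def)
qed

lemma exists_complete_bipartite_small_side:
  fixes \<epsilon> :: real and t :: nat
  assumes fin: "finite B" "finite M" and ne: "M \<noteq> {}" and \<epsilon>: "0 \<le> \<epsilon>"
    and dense: "\<epsilon> * (card B * card M) \<le> card (R\<inverse> \<inter> B \<times> M)"
    and M: "t \<le> \<epsilon> / 2 * card M" and B: "real (2 ^ card M * t) < \<epsilon> / 2 * card B"
  shows "\<exists>S\<subseteq>M. \<exists>W\<subseteq>B. t \<le> card S \<and> t < card W \<and> S \<times> W \<subseteq> R"
proof -
  define nbh where "nbh b = R\<inverse> `` {b} \<inter> M" for b
  define Y where "Y = {b \<in> B. \<epsilon> / 2 * card M \<le> card (nbh b)}"
  have "\<epsilon> / 2 * card B \<le> card Y"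
    unfolding Y_def nbh_def using fin ne \<epsilon> dense by (rule card_high_degree_ge)
  then have "2 ^ card M * t < card Y" using B by linarith
  then have "\<not> card Y \<le> card (Pow M) * t" using fin(2) by (simp add: card_Pow)
  moreover have "card Y \<le> card (Pow M) * t" if "\<And>S. S \<in> Pow M \<Longrightarrow> card {b \<in> Y. nbh b = S} \<le> t"
    using fin(2) that by (intro card_le_mult_if_card_fibers_le[where f = nbh]) (auto simp: nbh_def)
  ultimately obtain S where S: "S \<subseteq> M" "t < card {b \<in> Y. nbh b = S}"
    by (meson PowD not_le)
  define W where "W = {b \<in> Y. nbh b = S}"
  have card_W: "t < card W" using S(2) by (simp add: W_def)
  then have "W \<noteq> {}" by auto
  then have "\<epsilon> / 2 * card M \<le> card S" by (auto simp: W_def Y_def)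
  then have "t \<le> card S" using M by linarith
  moreover have "W \<subseteq> B" "S \<times> W \<subseteq> R" by (auto simp: W_def Y_def nbh_def)
  ultimately show ?thesis using S(1) card_W by blast
qed

theorem dense_relation_contains_complete_bipartite:
  assumes \<epsilon>: "0 < (\<epsilon>::real)"
  shows "\<exists>N. \<forall>(A :: 'a set) (B :: 'b set) R. finite A \<longrightarrow> finite B \<longrightarrow> N \<le> card A \<longrightarrow> N \<le> card B \<longrightarrow>
    \<epsilon> * (card A * card B) \<le> card (R \<inter> A \<times> B) \<longrightarrow>
    (\<exists>S\<subseteq>A. \<exists>W\<subseteq>B. t \<le> card S \<and> t \<le> card W \<and> S \<times> W \<subseteq> R)"
proof -
  obtain m :: nat where m_large: "4 * real t + 1 \<le> m * \<epsilon>"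
    using \<epsilon> reals_Archimedean3[of \<epsilon>] by (meson less_imp_le)
  define b where "b = 2 ^ m * t"
  obtain N :: nat where N_large: "4 * real (m + b) + 1 \<le> N * \<epsilon>"
    using \<epsilon> reals_Archimedean3[of \<epsilon>] by (meson less_imp_le)
  have "\<exists>S\<subseteq>A. \<exists>W\<subseteq>B. t \<le> card S \<and> t \<le> card W \<and> S \<times> W \<subseteq> R"
    if fin: "finite A" "finite B" and large: "N \<le> card A" "N \<le> card B"
      and dense: "\<epsilon> * (card A * card B) \<le> card (R \<inter> A \<times> B)"
    for A :: "'a set" and B :: "'b set" and R
  proof -
    have "N * \<epsilon> \<le> card A * \<epsilon>" "N * \<epsilon> \<le> card B * \<epsilon>" using large \<epsilon> by simp_all
    then have card_A: "m \<le> \<epsilon> / 2 * card A" and card_B: "b < \<epsilon> / 2 / 2 * card B"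
      using N_large by (simp_all add: mult.commute)
    have "B \<noteq> {}" using card_B by auto
    then obtain M where M: "M \<subseteq> A" "card M = m" "finite M"
      and dense_M: "\<epsilon> / 2 * (card B * card M) \<le> card (R\<inverse> \<inter> B \<times> M)"
      using exists_small_side_dense[OF fin _ _ dense card_A] \<epsilon> by auto
    have "M \<noteq> {}" using m_large M(2) by auto
    then obtain S W where SW: "S \<subseteq> M" "W \<subseteq> B" "t \<le> card S" "t < card W" "S \<times> W \<subseteq> R"
      using exists_complete_bipartite_small_side[OF fin(2) M(3) _ _ dense_M, of t]
        m_large \<epsilon> card_B M(2)
      by (auto simp: b_def mult.commute)
    then have "S \<subseteq> A" "t \<le> card W" using M(1) by auto
    then show ?thesis using SW by blast
  qed
  then show ?thesis by blast
qed

section \<open>Edge-disjoint triangles\<close>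

definition adjacency :: "'a set set \<Rightarrow> ('a \<times> 'a) set" where
  "adjacency G = {(x, y). {x, y} \<in> G}"

definition triangle_set :: "'a set set \<Rightarrow> 'a set set" where
  "triangle_set G = {T. card T = 3 \<and> [T]\<^bsup>2\<^esup> \<subseteq> G}"

abbreviation shadow :: "'a set set \<Rightarrow> 'a set set" where
  "shadow \<T> \<equiv> (\<Union>T\<in>\<T>. [T]\<^bsup>2\<^esup>)"

abbreviation edge_disjoint :: "'a set set \<Rightarrow> bool" where
  "edge_disjoint \<T> \<equiv> disjoint_family_on (\<lambda>T. [T]\<^bsup>2\<^esup>) \<T>"

lemma distinct_if_edge: "G \<subseteq> [V]\<^bsup>2\<^esup> \<Longrightarrow> {x, y} \<in> G \<Longrightarrow> x \<noteq> y"
  by (metis doubleton_in_nsets_2 subsetD)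

lemma card_le_card_adjacency:
  assumes "finite V" "G \<subseteq> [V]\<^bsup>2\<^esup>"
  shows "card G \<le> card (adjacency G \<inter> V \<times> V)"
proof (rule surj_card_le)
  show "G \<subseteq> (\<lambda>(x, y). {x, y}) ` (adjacency G \<inter> V \<times> V)"
  proof
    fix e assume e: "e \<in> G"
    then have "e \<in> [V]\<^bsup>2\<^esup>" using assms(2) by blast
    then obtain x y where "e = {x, y}" "x \<in> V" "y \<in> V" by (rule nsets2_E)
    then show "e \<in> (\<lambda>(x, y). {x, y}) ` (adjacency G \<inter> V \<times> V)"
      using e by (intro image_eqI[of _ _ "(x, y)"]) (auto simp: adjacency_def)
  qed
qed (use assms(1) in simp)

lemma triangle_set_mono: "G \<subseteq> G' \<Longrightarrow> triangle_set G \<subseteq> triangle_set G'"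
  by (auto simp: triangle_set_def)

lemma triangle_set_iff:
  "T \<in> triangle_set G \<longleftrightarrow>
    (\<exists>x y z. T = {x, y, z} \<and> x \<noteq> y \<and> x \<noteq> z \<and> y \<noteq> z \<and> {x, y} \<in> G \<and> {x, z} \<in> G \<and> {y, z} \<in> G)"
  (is "?lhs \<longleftrightarrow> ?rhs")
proof
  assume ?lhs
  then obtain x y z where T: "T = {x, y, z}" "x \<noteq> y" "x \<noteq> z" "y \<noteq> z" and G: "[T]\<^bsup>2\<^esup> \<subseteq> G"
    by (auto simp: triangle_set_def card_3_iff)
  have "{x, y} \<in> [T]\<^bsup>2\<^esup>" "{x, z} \<in> [T]\<^bsup>2\<^esup>" "{y, z} \<in> [T]\<^bsup>2\<^esup>" using T by simp_all
  then show ?rhs using T G by blast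
next
  assume ?rhs
  then show ?lhs by (auto simp: triangle_set_def nsets_2_eq insert_commute)
qed

lemma triangle_set_subset_nsets:
  assumes "G \<subseteq> [V]\<^bsup>2\<^esup>"
  shows "triangle_set G \<subseteq> [V]\<^bsup>3\<^esup>"
proof
  fix T assume "T \<in> triangle_set G"
  then obtain x y z where T: "T = {x, y, z}" "x \<noteq> y" "x \<noteq> z" "y \<noteq> z"
    and "{x, y} \<in> G" "{x, z} \<in> G" "{y, z} \<in> G"
    unfolding triangle_set_iff by blast
  then have "{x, y} \<in> [V]\<^bsup>2\<^esup>" "{x, z} \<in> [V]\<^bsup>2\<^esup>" using assms by blast+
  then show "T \<in> [V]\<^bsup>3\<^esup>" using T by (simp add: nsets_def)
qed

lemma finite_triangle_set: "finite V \<Longrightarrow> G \<subseteq> [V]\<^bsup>2\<^esup> \<Longrightarrow> finite (triangle_set G)"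
  by (meson finite_imp_finite_nsets finite_subset triangle_set_subset_nsets)

lemma card_triangle_triples_adjacency_le:
  assumes "finite V" and G: "G \<subseteq> [V]\<^bsup>2\<^esup>"
  shows "card (triangle_triples (adjacency G) V V V) \<le> card (triangle_set G) * 27"
proof (rule card_le_mult_if_card_fibers_le[where f = "\<lambda>(x, y, z). {x, y, z}"])
  show "(\<lambda>(x, y, z). {x, y, z}) ` triangle_triples (adjacency G) V V V \<subseteq> triangle_set G"
  proof clarify
    fix x y z assume "(x, y, z) \<in> triangle_triples (adjacency G) V V V"
    then have "{x, y} \<in> G" "{x, z} \<in> G" "{y, z} \<in> G"
      by (simp_all add: triangle_triples_def adjacency_def)
    then show "{x, y, z} \<in> triangle_set G"
      unfolding triangle_set_iff using distinct_if_edge[OF G] by blast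
  qed
next
  fix T assume "T \<in> triangle_set G"
  then have T: "card T = 3" "finite T" by (auto simp: triangle_set_def card_ge_0_finite)
  let ?F = "{t \<in> triangle_triples (adjacency G) V V V. (\<lambda>(x, y, z). {x, y, z}) t = T}"
  have "?F \<subseteq> T \<times> T \<times> T" by auto
  then have "card ?F \<le> card (T \<times> T \<times> T)" using T by (intro card_mono) auto
  then show "card ?F \<le> 27" using T by (simp add: card_cartesian_product)
qed (use assms in \<open>rule finite_triangle_set\<close>)

lemma card_edges_in_triangles_le:
  assumes fin: "finite (triangle_set G)"
    and L: "\<And>e. e \<in> L \<Longrightarrow> card e = 2" "\<And>e. e \<in> L \<Longrightarrow> \<exists>T\<in>triangle_set G. e \<subseteq> T"
  shows "card L \<le> 3 * card (triangle_set G)"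
proof -
  have "L \<subseteq> shadow (triangle_set G)"
    using L by (fastforce simp: nsets_def card_ge_0_finite)
  moreover have "finite ([T]\<^bsup>2\<^esup>)" if "T \<in> triangle_set G" for T
    using that by (intro finite_imp_finite_nsets card_ge_0_finite) (simp add: triangle_set_def)
  ultimately have "card L \<le> card (shadow (triangle_set G))"
    using fin by (intro card_mono finite_UN_I)
  also have "\<dots> \<le> (\<Sum>T\<in>triangle_set G. card ([T]\<^bsup>2\<^esup>))" by (rule card_UN_le[OF fin])
  also have "\<dots> = 3 * card (triangle_set G)" by (simp add: triangle_set_def choose_two)
  finally show ?thesis .
qed

lemma triangle_set_delete_pairs:
  assumes G: "G \<subseteq> [V]\<^bsup>2\<^esup>" and no_triples: "triangle_triples (adjacency G - D) V V V = {}"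
  shows "triangle_set (G - (\<lambda>(x, y). {x, y}) ` D) = {}"
proof -
  let ?D = "(\<lambda>(x, y). {x, y}) ` D"
  have "T \<notin> triangle_set (G - ?D)" for T
  proof
    assume "T \<in> triangle_set (G - ?D)"
    then obtain x y z where xyz: "{x, y} \<in> G - ?D" "{x, z} \<in> G - ?D" "{y, z} \<in> G - ?D"
      unfolding triangle_set_iff by blast
    then have "{x, y} \<in> [V]\<^bsup>2\<^esup>" "{y, z} \<in> [V]\<^bsup>2\<^esup>" using G by blast+
    then have "(x, y, z) \<in> triangle_triples (adjacency G - D) V V V"
      using xyz by (force simp: triangle_triples_def adjacency_def)
    then show False using no_triples by simp
  qed
  then show ?thesis by blast
qed

theorem triangle_removal_graph:
  assumes "0 < (\<epsilon>::real)"
  shows "\<exists>\<delta>>0. \<forall>(V :: 'a set) G. finite V \<longrightarrow> G \<subseteq> [V]\<^bsup>2\<^esup> \<longrightarrow>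
    card (triangle_set G) < \<delta> * real (card V) ^ 3 \<longrightarrow>
    (\<exists>D. finite D \<and> card D \<le> \<epsilon> * (real (card V))\<^sup>2 \<and> triangle_set (G - D) = {})"
proof -
  obtain \<delta> where \<delta>: "0 < \<delta>" and removal: "\<And>(V :: 'a set) R. finite V \<Longrightarrow>
    card (triangle_triples R V V V) < \<delta> * real (card V) ^ 3 \<Longrightarrow>
    \<exists>D\<subseteq>V \<times> V. card D \<le> \<epsilon> * (real (card V))\<^sup>2 \<and> triangle_triples (R - D) V V V = {}"
    using triangle_removal[OF assms, where 'a = 'a] by blast
  have "\<exists>D. finite D \<and> card D \<le> \<epsilon> * (real (card V))\<^sup>2 \<and> triangle_set (G - D) = {}"
    if fin: "finite V" and G: "G \<subseteq> [V]\<^bsup>2\<^esup>"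
      and few: "card (triangle_set G) < \<delta> / 27 * real (card V) ^ 3"
    for V :: "'a set" and G
  proof -
    have "real (card (triangle_triples (adjacency G) V V V)) \<le> real (card (triangle_set G) * 27)"
      using card_triangle_triples_adjacency_le[OF fin G] by (rule of_nat_mono)
    then have "card (triangle_triples (adjacency G) V V V) < \<delta> * real (card V) ^ 3"
      using few by simp
    then obtain D where D: "D \<subseteq> V \<times> V" "card D \<le> \<epsilon> * (real (card V))\<^sup>2"
      and no_triples: "triangle_triples (adjacency G - D) V V V = {}"
      using removal[OF fin] by blast
    have "finite D" using D(1) fin finite_subset by blast
    then have "card ((\<lambda>(x, y). {x, y}) ` D) \<le> card D" by (rule card_image_le)
    then show ?thesis
      using D(2) \<open>finite D\<close> triangle_set_delete_pairs[OF G no_triples]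
      by (intro exI[of _ "(\<lambda>(x, y). {x, y}) ` D"]) auto
  qed
  then show ?thesis using \<delta> by (intro exI[of _ "\<delta> / 27"]) simp
qed

lemma card_edge_disjoint_triangles_le:
  assumes \<T>: "\<T> \<subseteq> triangle_set G" "edge_disjoint \<T>"
    and D: "finite D" "triangle_set (G - D) = {}"
  shows "card \<T> \<le> card D"
proof -
  have "\<forall>T\<in>\<T>. \<exists>p. p \<in> [T]\<^bsup>2\<^esup> \<inter> D"
  proof
    fix T assume "T \<in> \<T>"
    then have "T \<in> triangle_set G" "T \<notin> triangle_set (G - D)" using \<T>(1) D(2) by auto
    then show "\<exists>p. p \<in> [T]\<^bsup>2\<^esup> \<inter> D" by (auto simp: triangle_set_def)
  qed
  then obtain f where f: "\<forall>T\<in>\<T>. f T \<in> [T]\<^bsup>2\<^esup> \<inter> D" by metis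
  then have "inj_on f \<T>"
    using disjoint_family_onD[OF \<T>(2)] by (intro inj_onI) (metis IntD1 disjoint_iff)
  then show ?thesis using f D(1) by (intro card_inj_on_le[of f]) auto
qed

theorem edge_disjoint_triangles_sparse:
  fixes \<epsilon> C :: real
  assumes \<epsilon>: "0 < \<epsilon>"
  shows "\<forall>\<^sub>F n in sequentially. \<forall>\<T>. \<T> \<subseteq> [{..<n}]\<^bsup>3\<^esup> \<longrightarrow> edge_disjoint \<T> \<longrightarrow>
    card (triangle_set (shadow \<T>)) \<le> C * (real n)\<^sup>2 \<longrightarrow> card \<T> \<le> \<epsilon> * (real n)\<^sup>2"
proof -
  obtain \<delta> where \<delta>: "0 < \<delta>" and removal: "\<And>(V :: nat set) G. finite V \<Longrightarrow> G \<subseteq> [V]\<^bsup>2\<^esup> \<Longrightarrow>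
    card (triangle_set G) < \<delta> * real (card V) ^ 3 \<Longrightarrow>
    \<exists>D. finite D \<and> card D \<le> \<epsilon> * (real (card V))\<^sup>2 \<and> triangle_set (G - D) = {}"
    using triangle_removal_graph[OF \<epsilon>, where 'a = nat] by blast
  have "\<forall>\<^sub>F n in sequentially. max 0 (C / \<delta>) < real n"
    using filterlim_at_top_dense[THEN iffD1, OF filterlim_real_sequentially] by blast
  then show ?thesis
  proof (eventually_elim, intro allI impI)
    fix n \<T>
    assume n_large: "max 0 (C / \<delta>) < real n" and \<T>: "\<T> \<subseteq> [{..<n}]\<^bsup>3\<^esup>" "edge_disjoint \<T>"
      and few: "card (triangle_set (shadow \<T>)) \<le> C * (real n)\<^sup>2"
    let ?G = "shadow \<T>"
    have G: "?G \<subseteq> [{..<n}]\<^bsup>2\<^esup>" using \<T>(1) nsets_mono by (fastforce simp: nsets_def)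
    have "C * (real n)\<^sup>2 < (\<delta> * n) * (real n)\<^sup>2"
      using n_large \<delta>
      by (intro mult_strict_right_mono) (simp_all add: pos_divide_less_eq mult.commute)
    also have "\<dots> = \<delta> * real n ^ 3" by (simp add: power2_eq_square power3_eq_cube)
    finally have "card (triangle_set ?G) < \<delta> * real (card {..<n}) ^ 3" using few by simp
    then obtain D where D: "finite D" "card D \<le> \<epsilon> * (real n)\<^sup>2" "triangle_set (?G - D) = {}"
      using removal[OF _ G] by auto
    have "\<T> \<subseteq> triangle_set ?G" using \<T>(1) by (auto simp: triangle_set_def nsets_def)
    then have "card \<T> \<le> card D" using \<T>(2) D(1,3) by (rule card_edge_disjoint_triangles_le)
    then show "card \<T> \<le> \<epsilon> * (real n)\<^sup>2" using D(2) by linarith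
  qed
qed

section \<open>Transversals and independent sets\<close>

lemma exists_card_le_by_averaging:
  assumes fin: "finite D" "finite P" "P \<noteq> {}"
    and often: "\<And>T. T \<in> D \<Longrightarrow> card P \<le> c * card {a \<in> P. R T a}"
  shows "\<exists>a\<in>P. card D \<le> c * card {T \<in> D. R T a}"
proof (rule ccontr)
  assume "\<not> ?thesis"
  then have rare: "c * card {T \<in> D. R T a} < card D" if "a \<in> P" for a
    using that by (auto simp: not_le)
  have "card D * card P = (\<Sum>T\<in>D. card P)" by simp
  also have "\<dots> \<le> (\<Sum>T\<in>D. c * card {a \<in> P. R T a})" by (intro sum_mono often)
  also have "\<dots> = c * (\<Sum>a\<in>P. card {T \<in> D. R T a})"
    using sum_multicount_gen[OF fin(1,2), of R "\<lambda>a. card {T \<in> D. R T a}"]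
    by (simp flip: sum_distrib_left)
  also have "\<dots> = (\<Sum>a\<in>P. c * card {T \<in> D. R T a})" by (simp add: sum_distrib_left)
  also have "\<dots> < (\<Sum>a\<in>P. card D)" using rare fin by (intro sum_strict_mono) auto
  finally show False by (simp add: mult.commute)
qed

lemma card_disjoint_family_meeting_le:
  assumes fin: "finite S" "finite Q" and disj: "disjoint_family_on B S"
  shows "card {h \<in> S. Q \<inter> B h \<noteq> {}} \<le> card Q"
proof -
  let ?K = "{h \<in> S. Q \<inter> B h \<noteq> {}}"
  have "card ?K = (\<Sum>h\<in>?K. 1)" by simp
  also have "\<dots> \<le> (\<Sum>h\<in>?K. card (Q \<inter> B h))"
    using fin(2) by (intro sum_mono) (simp add: Suc_le_eq card_gt_0_iff)
  also have "\<dots> = card (\<Union>h\<in>?K. Q \<inter> B h)"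
    using fin disj by (intro card_UN_disjoint'[symmetric]) (auto simp: disjoint_family_on_def)
  also have "\<dots> \<le> card Q" using fin(2) by (intro card_mono) auto
  finally show ?thesis .
qed

lemma transversals_through_subset:
  assumes Q: "Q \<subseteq> (\<Union>h\<in>S. B h)" and single: "\<And>h. h \<in> K \<Longrightarrow> card (Q \<inter> B h) = 1"
    and K: "K = {h \<in> S. Q \<inter> B h \<noteq> {}}"
  shows "Pi\<^sub>E S (\<lambda>h. if h \<in> K then Q \<inter> B h else B h) \<subseteq> {a \<in> Pi\<^sub>E S B. Q \<subseteq> a ` S}"
proof (intro subsetI CollectI conjI)
  fix a assume a: "a \<in> Pi\<^sub>E S (\<lambda>h. if h \<in> K then Q \<inter> B h else B h)"
  show "a \<in> Pi\<^sub>E S B" using a by (auto simp: PiE_iff split: if_splits)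
  fix e assume e: "e \<in> Q"
  then obtain h where h: "h \<in> S" "e \<in> B h" using Q by blast
  then have "h \<in> K" using e by (auto simp: K)
  moreover from this have "a h \<in> Q \<inter> B h" using a h(1) by (auto simp: PiE_iff)
  ultimately have "a h = e" using single h e by (metis IntI card_1_singletonE singletonD)
  then show "e \<in> a ` S" using h(1) by blast
qed

text \<open>A uniformly random transversal contains \<open>Q\<close> with probability at least \<open>1 / k ^ card Q\<close>.\<close>

lemma card_transversals_le:
  assumes fin: "finite S" and card_B: "\<And>h. h \<in> S \<Longrightarrow> card (B h) = k" "0 < k"
    and disj: "disjoint_family_on B S"
    and Q: "finite Q" "Q \<subseteq> (\<Union>h\<in>S. B h)" and rainbow: "\<And>h. h \<in> S \<Longrightarrow> card (Q \<inter> B h) \<le> 1"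
  shows "card (Pi\<^sub>E S B) \<le> k ^ card Q * card {a \<in> Pi\<^sub>E S B. Q \<subseteq> a ` S}"
proof -
  define K where "K = {h \<in> S. Q \<inter> B h \<noteq> {}}"
  define C where "C h = (if h \<in> K then Q \<inter> B h else B h)" for h
  have K: "K \<subseteq> S" "finite K" using fin by (auto simp: K_def)
  have single: "card (Q \<inter> B h) = 1" if "h \<in> K" for h
  proof -
    have "0 < card (Q \<inter> B h)" using that Q(1) by (auto simp: K_def card_gt_0_iff)
    then show ?thesis using rainbow[of h] that by (auto simp: K_def)
  qed
  have card_K: "card K \<le> card Q"
    unfolding K_def using fin Q(1) disj by (rule card_disjoint_family_meeting_le)
  have "card (Pi\<^sub>E S B) = k ^ card S" using fin card_B by (simp add: card_PiE)
  also have "card S = card K + card (S - K)"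
    using K fin by (simp add: card_Diff_subset card_mono)
  also have "k ^ (card K + card (S - K)) \<le> k ^ card Q * k ^ card (S - K)"
    using card_K card_B(2) by (simp add: power_add power_increasing)
  also have "k ^ card (S - K) = (\<Prod>h\<in>S. if h \<in> K then 1 else k)"
    using fin by (simp add: prod.If_cases Diff_eq)
  also have "\<dots> = card (Pi\<^sub>E S C)"
    using fin card_B single by (simp add: card_PiE C_def) (intro prod.cong; simp)
  also have "finite (Pi\<^sub>E S B)"
    using fin card_B by (intro finite_PiE) (auto intro: card_ge_0_finite)
  then have "card (Pi\<^sub>E S C) \<le> card {a \<in> Pi\<^sub>E S B. Q \<subseteq> a ` S}"
    unfolding C_def using transversals_through_subset[OF Q(2) single K_def]
    by (intro card_mono) auto
  finally show ?thesis by simp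
qed

lemma card_edge_disjoint_triples_le:
  assumes fin: "finite V" and \<T>: "\<T> \<subseteq> [V]\<^bsup>3\<^esup>" "edge_disjoint \<T>"
  shows "3 * card \<T> \<le> card V choose 2"
proof -
  have triple: "card T = 3" "finite T" "T \<subseteq> V" if "T \<in> \<T>" for T
    using \<T>(1) that by (auto simp: nsets_def)
  have finite_\<T>: "finite \<T>" using \<T>(1) fin finite_imp_finite_nsets finite_subset by blast
  have "3 * card \<T> = (\<Sum>T\<in>\<T>. card ([T]\<^bsup>2\<^esup>))" using triple(1) by (simp add: choose_two)
  also have "\<dots> = card (shadow \<T>)"
    using triple(2) by (intro card_UN_disjoint'[symmetric] \<T>(2) finite_\<T> finite_imp_finite_nsets)
  also have "\<dots> \<le> card ([V]\<^bsup>2\<^esup>)"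
    using triple(3) by (intro card_mono finite_imp_finite_nsets fin UN_least nsets_mono)
  finally show ?thesis by simp
qed

lemma card_Int_nsets_2_le:
  assumes "card T = 3" "card T' = 3" "T \<noteq> T'"
  shows "card ([T]\<^bsup>2\<^esup> \<inter> [T']\<^bsup>2\<^esup>) \<le> 1"
proof -
  have fin: "finite T" "finite T'" using assms by (auto intro: card_ge_0_finite)
  have "\<not> T \<subseteq> T'" using card_subset_eq[OF fin(2)] assms by auto
  then have "card (T \<inter> T') < 3" using psubset_card_mono[OF fin(1), of "T \<inter> T'"] assms(1) by auto
  then have "card (T \<inter> T') choose 2 \<le> 1" by (auto simp: less_Suc_eq numeral_eq_Suc)
  moreover have "[T]\<^bsup>2\<^esup> \<inter> [T']\<^bsup>2\<^esup> = [T \<inter> T']\<^bsup>2\<^esup>" by (auto simp: nsets_def)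
  ultimately show ?thesis by simp
qed

lemma exists_transversal_many_triangles:
  assumes fin: "finite \<T>" and card_T: "\<And>T. T \<in> \<T> \<Longrightarrow> card T = 3"
    and disj: "edge_disjoint \<T>"
  shows "\<exists>a\<in>\<Pi>\<^sub>E T\<in>\<T>. [T]\<^bsup>2\<^esup>.
    card (triangle_set (shadow \<T>) - \<T>) \<le> 27 * card (triangle_set (a ` \<T>))"
proof -
  let ?B = "\<lambda>T. [T]\<^bsup>2\<^esup>" and ?G = "shadow \<T>"
  let ?D = "triangle_set ?G - \<T>"
  have finite_T: "finite T" if "T \<in> \<T>" for T using card_T[OF that] by (simp add: card_ge_0_finite)
  have G: "?G \<subseteq> [\<Union>\<T>]\<^bsup>2\<^esup>" by (auto simp: nsets_def)
  have fin_triangles: "finite (triangle_set G)" if "G \<subseteq> ?G" for G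
    using fin finite_T that G by (intro finite_triangle_set[of "\<Union>\<T>"]) auto
  have card_B: "card (?B T) = 3" if "T \<in> \<T>" for T using card_T[OF that] by (simp add: choose_two)
  have "finite (Pi\<^sub>E \<T> ?B)"
    using fin finite_T by (intro finite_PiE finite_imp_finite_nsets)
  moreover have "?B T \<noteq> {}" if "T \<in> \<T>" for T
    using card_B[OF that] by (metis card.empty zero_neq_numeral)
  then have "Pi\<^sub>E \<T> ?B \<noteq> {}" by (simp add: PiE_eq_empty_iff)
  ultimately have "\<exists>a\<in>Pi\<^sub>E \<T> ?B. card ?D \<le> 27 * card {T \<in> ?D. ?B T \<subseteq> a ` \<T>}"
  proof (rule exists_card_le_by_averaging[rotated])
    fix T assume T: "T \<in> ?D"
    then have card_3: "card T = 3" and sub: "?B T \<subseteq> ?G" by (auto simp: triangle_set_def)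
    have "card (?B T \<inter> ?B T') \<le> 1" if "T' \<in> \<T>" for T'
      using T card_3 card_T[OF that] that by (intro card_Int_nsets_2_le) auto
    then have "card (Pi\<^sub>E \<T> ?B) \<le> 3 ^ card (?B T) * card {a \<in> Pi\<^sub>E \<T> ?B. ?B T \<subseteq> a ` \<T>}"
      using card_3 sub by (intro card_transversals_le fin card_B disj)
        (auto intro: finite_imp_finite_nsets card_ge_0_finite)
    then show "card (Pi\<^sub>E \<T> ?B) \<le> 27 * card {a \<in> Pi\<^sub>E \<T> ?B. ?B T \<subseteq> a ` \<T>}"
      using card_3 by (simp add: choose_two)
  qed (simp add: fin_triangles)
  then obtain a where a: "a \<in> Pi\<^sub>E \<T> ?B" and rainbow: "card ?D \<le> 27 * card {T \<in> ?D. ?B T \<subseteq> a ` \<T>}"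
    by blast
  have "a ` \<T> \<subseteq> ?G" using a by (auto simp: PiE_iff)
  then have "card {T \<in> ?D. ?B T \<subseteq> a ` \<T>} \<le> card (triangle_set (a ` \<T>))"
    by (intro card_mono fin_triangles) (auto simp: triangle_set_def)
  then show ?thesis using a rainbow by (intro bexI[of _ a]) auto
qed

lemma exists_independent_set:
  assumes fin: "finite A" and sym: "\<And>x y. c x y \<Longrightarrow> c y x"
    and deg: "\<And>x. x \<in> A \<Longrightarrow> card {y \<in> A. y = x \<or> c x y} \<le> d"
  shows "\<exists>I\<subseteq>A. pairwise (\<lambda>x y. \<not> c x y) I \<and> card A \<le> card I * d"
proof -
  let ?S = "{I. I \<subseteq> A \<and> pairwise (\<lambda>x y. \<not> c x y) I}"
  have "finite ?S" "{} \<in> ?S" using fin by auto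
  then obtain I where I: "I \<in> ?S" and max: "\<And>J. J \<in> ?S \<Longrightarrow> I \<subseteq> J \<Longrightarrow> I = J"
    using finite_has_maximal[of ?S] by (metis (no_types, lifting) empty_iff)
  have "x \<in> (\<Union>y\<in>I. {x \<in> A. x = y \<or> c y x})" if x: "x \<in> A" for x
  proof (rule ccontr)
    assume "x \<notin> (\<Union>y\<in>I. {x \<in> A. x = y \<or> c y x})"
    then have "\<not> c y x" "\<not> c x y" "x \<notin> I" if "y \<in> I" for y using x that sym by blast+
    then have "insert x I \<in> ?S" "x \<notin> I" using I x by (auto simp: pairwise_insert)
    then show False using max[of "insert x I"] by blast
  qed
  moreover have finI: "finite I" using I fin finite_subset by blast
  ultimately have "card A \<le> card (\<Union>y\<in>I. {x \<in> A. x = y \<or> c y x})"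
    using fin by (intro card_mono) auto
  also have "\<dots> \<le> (\<Sum>y\<in>I. card {x \<in> A. x = y \<or> c y x})" by (rule card_UN_le[OF finI])
  also have "\<dots> \<le> (\<Sum>y\<in>I. d)" using I by (intro sum_mono deg) auto
  finally show ?thesis using I by auto
qed

definition has_cherry :: "'a set set \<Rightarrow> 'a set \<Rightarrow> bool" where
  "has_cherry G h \<longleftrightarrow> (\<exists>e w. e \<in> [h]\<^bsup>2\<^esup> - G \<and> w \<in> h - e \<and> (\<forall>x\<in>e. {x, w} \<in> G))"

lemma exists_independent_set_if_no_cherry:
  assumes fin: "finite h" and no_cherry: "\<not> has_cherry G h"
    and clique: "\<And>K. K \<subseteq> h \<Longrightarrow> [K]\<^bsup>2\<^esup> \<subseteq> G \<Longrightarrow> card K \<le> k" and large: "j * k < card h"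
  shows "\<exists>T\<in>[h]\<^bsup>Suc j\<^esup>. [T]\<^bsup>2\<^esup> \<inter> G = {}"
proof -
  let ?c = "\<lambda>x y. x \<noteq> y \<and> {x, y} \<in> G"
  have "\<exists>I\<subseteq>h. pairwise (\<lambda>x y. \<not> ?c x y) I \<and> card h \<le> card I * k"
  proof (rule exists_independent_set[OF fin])
    fix x assume x: "x \<in> h"
    show "card {y \<in> h. y = x \<or> ?c x y} \<le> k"
    proof (intro clique subsetI)
      fix e assume "e \<in> [{y \<in> h. y = x \<or> ?c x y}]\<^bsup>2\<^esup>"
      then obtain u v where e: "e = {u, v}" "u \<noteq> v" "u \<in> h" "v \<in> h"
        "u = x \<or> ?c x u" "v = x \<or> ?c x v"
        by (auto elim!: nsets2_E)
      show "e \<in> G"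
      proof (rule ccontr)
        assume "e \<notin> G"
        then have "u \<noteq> x" "v \<noteq> x" using e by (auto simp: insert_commute)
        then have "e \<in> [h]\<^bsup>2\<^esup> - G" "x \<in> h - e" "\<forall>y\<in>e. {y, x} \<in> G"
          using e x \<open>e \<notin> G\<close> by (auto simp: insert_commute)
        then show False using no_cherry unfolding has_cherry_def by blast
      qed
    qed auto
  qed (auto simp: insert_commute)
  then obtain I where I: "I \<subseteq> h" "pairwise (\<lambda>x y. \<not> ?c x y) I" "card h \<le> card I * k" by blast
  have "j * k < card I * k" using large I(3) by linarith
  then have "Suc j \<le> card I" by simp
  then obtain T where T: "T \<subseteq> I" "card T = Suc j" "finite T" by (rule obtain_subset_with_card_n)
  have "e \<notin> G" if "e \<in> [T]\<^bsup>2\<^esup>" for e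
    using that T(1) pairwiseD[OF I(2)] by (metis nsets2_E subsetD)
  moreover have "T \<in> [h]\<^bsup>Suc j\<^esup>" using T I(1) by (auto simp: nsets_def)
  ultimately show ?thesis by blast
qed

section \<open>Colorings and copies\<close>

definition proper_coloring :: "'a set \<Rightarrow> 'a set set \<Rightarrow> nat \<Rightarrow> ('a \<Rightarrow> nat) \<Rightarrow> bool" where
  "proper_coloring V E k c \<longleftrightarrow>
     (\<forall>v\<in>V. c v < k) \<and> (\<forall>e\<in>E. \<forall>u\<in>e. \<forall>v\<in>e. u \<noteq> v \<longrightarrow> c u \<noteq> c v)"

lemma graph_on_iff: "graph_on V E \<longleftrightarrow> finite V \<and> E \<subseteq> [V]\<^bsup>2\<^esup>"
  by (auto simp: graph_on_def nsets_def card_ge_0_finite)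

lemma finite_edges: "graph_on V E \<Longrightarrow> finite E"
  by (meson finite_imp_finite_nsets finite_subset graph_on_iff)

lemma graph_on_edgeE:
  assumes "graph_on V E" "e \<in> E"
  obtains u v where "e = {u, v}" "u \<noteq> v" "u \<in> V" "v \<in> V"
proof -
  have "e \<in> [V]\<^bsup>2\<^esup>" using assms by (auto simp: graph_on_iff)
  then show ?thesis using that by (blast elim: nsets2_E)
qed

lemma host_graph_iff: "host_graph n G \<longleftrightarrow> G \<subseteq> [{..<n}]\<^bsup>2\<^esup>"
  by (auto simp: host_graph_def nsets_def card_ge_0_finite)

lemma chromatic_number_eq: "chromatic_number V E = (LEAST k. \<exists>c. proper_coloring V E k c)"
  by (simp add: chromatic_number_def proper_coloring_def)

lemma proper_coloring_chromatic_number: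
  assumes "graph_on V E"
  obtains c where "proper_coloring V E (chromatic_number V E) c"
proof -
  have "finite V" using assms by (simp add: graph_on_def)
  then obtain f :: "'a \<Rightarrow> nat" and k where f: "f ` V = {i. i < k}" "inj_on f V"
    using finite_imp_inj_to_nat_seg by metis
  have "f u \<noteq> f v" if "e \<in> E" "u \<in> e" "v \<in> e" "u \<noteq> v" for e u v
    using assms f(2) that by (metis graph_on_def inj_onD subsetD)
  then have "proper_coloring V E k f" using f(1) by (auto simp: proper_coloring_def)
  then have "\<exists>c. proper_coloring V E (chromatic_number V E) c"
    unfolding chromatic_number_eq by (rule LeastI[of "\<lambda>k. \<exists>c. proper_coloring V E k c", OF exI])
  then show ?thesis using that by blast
qed

lemma chromatic_number_ge_2:
  assumes "graph_on V E" "E \<noteq> {}"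
  shows "2 \<le> chromatic_number V E"
proof -
  obtain c where coloring: "proper_coloring V E (chromatic_number V E) c"
    using proper_coloring_chromatic_number[OF assms(1)] .
  obtain e where "e \<in> E" using assms(2) by blast
  moreover from this obtain u v where "e = {u, v}" "u \<noteq> v" "u \<in> V" "v \<in> V"
    using graph_on_edgeE[OF assms(1)] by blast
  ultimately have "c u \<noteq> c v" "c u < chromatic_number V E" "c v < chromatic_number V E"
    using coloring by (auto simp: proper_coloring_def)
  then show ?thesis by linarith
qed

lemma contains_copy_complete_bipartite:
  assumes F: "graph_on V E" "proper_coloring V E 2 c"
    and parts: "S \<subseteq> {..<n}" "W \<subseteq> {..<n}" "S \<inter> W = {}" "card V \<le> card S" "card V \<le> card W"
    and G: "\<And>x y. x \<in> S \<Longrightarrow> y \<in> W \<Longrightarrow> {x, y} \<in> G"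
  shows "contains_copy V E n G"
proof -
  have fin: "finite V" "finite S" "finite W"
    using F(1) parts by (auto simp: graph_on_def intro: finite_subset)
  obtain f where f: "inj_on f V" "f ` V \<subseteq> S" using inj_on_iff_card_le[OF fin(1,2)] parts by auto
  obtain g where g: "inj_on g V" "g ` V \<subseteq> W" using inj_on_iff_card_le[OF fin(1,3)] parts by auto
  define \<phi> where "\<phi> v = (if c v = 0 then f v else g v)" for v
  have "f u \<noteq> g v" if "u \<in> V" "v \<in> V" for u v using f(2) g(2) parts(3) that by blast
  then have "inj_on \<phi> V"
    using f(1) g(1) unfolding \<phi>_def inj_on_def by metis
  moreover have "\<phi> ` V \<subseteq> {..<n}" using f g parts by (auto simp: \<phi>_def)
  moreover have "\<phi> ` e \<in> G" if edge: "e \<in> E" for e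
  proof -
    obtain u v where e: "e = {u, v}" "u \<noteq> v" "u \<in> V" "v \<in> V"
      using graph_on_edgeE[OF F(1) edge] .
    then have "c u \<noteq> c v" "c u < 2" "c v < 2" using F(2) edge by (auto simp: proper_coloring_def)
    then consider (u_left) "c u = 0" "c v \<noteq> 0" | (v_left) "c v = 0" "c u \<noteq> 0" by linarith
    then show ?thesis
    proof cases
      case u_left
      then have "\<phi> ` e = {f u, g v}" using e(1) by (auto simp: \<phi>_def)
      then show ?thesis using G[of "f u" "g v"] f(2) g(2) e(3,4) by auto
    next
      case v_left
      then have "\<phi> ` e = {f v, g u}" using e(1) by (auto simp: \<phi>_def)
      then show ?thesis using G[of "f v" "g u"] f(2) g(2) e(3,4) by auto
    qed
  qed
  ultimately show ?thesis unfolding contains_copy_def by blast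
qed

lemma dense_graph_contains_bipartite:
  assumes F: "graph_on V E" "proper_coloring V E 2 c" and \<epsilon>: "0 < (\<epsilon>::real)"
  shows "\<forall>\<^sub>F n in sequentially. \<forall>G. host_graph n G \<longrightarrow> \<epsilon> * (real n)\<^sup>2 \<le> card G \<longrightarrow>
    contains_copy V E n G"
proof -
  obtain N where N: "\<forall>(A :: nat set) (B :: nat set) R. finite A \<longrightarrow> finite B \<longrightarrow>
    N \<le> card A \<longrightarrow> N \<le> card B \<longrightarrow> \<epsilon> * (card A * card B) \<le> card (R \<inter> A \<times> B) \<longrightarrow>
    (\<exists>S\<subseteq>A. \<exists>W\<subseteq>B. card V \<le> card S \<and> card V \<le> card W \<and> S \<times> W \<subseteq> R)"
    using dense_relation_contains_complete_bipartite[OF \<epsilon>] by (rule exE)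
  have "contains_copy V E n G"
    if n_large: "N \<le> n" and G: "host_graph n G" and dense: "\<epsilon> * (real n)\<^sup>2 \<le> card G" for n G
  proof -
    have edges: "G \<subseteq> [{..<n}]\<^bsup>2\<^esup>" using G by (simp add: host_graph_iff)
    then have "card G \<le> card (adjacency G \<inter> {..<n} \<times> {..<n})" by (intro card_le_card_adjacency) auto
    then have "\<epsilon> * (card {..<n} * card {..<n}) \<le> card (adjacency G \<inter> {..<n} \<times> {..<n})"
      using dense by (simp add: power2_eq_square)
    then obtain S W where SW: "S \<subseteq> {..<n}" "W \<subseteq> {..<n}" "card V \<le> card S" "card V \<le> card W"
      "S \<times> W \<subseteq> adjacency G"
      using N[rule_format, of "{..<n}" "{..<n}" "adjacency G"] n_large by auto
    then have complete: "{x, y} \<in> G" if "x \<in> S" "y \<in> W" for x y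
      using that by (auto simp: adjacency_def)
    then have "S \<inter> W = {}" using distinct_if_edge[OF edges] by blast
    then show ?thesis
      using SW complete by (intro contains_copy_complete_bipartite[OF F, of S n W]) auto
  qed
  then show ?thesis unfolding eventually_sequentially by blast
qed

lemma contains_copy_clique:
  assumes F: "graph_on V E" and K: "K \<subseteq> {..<n}" "card V \<le> card K" "[K]\<^bsup>2\<^esup> \<subseteq> G"
  shows "contains_copy V E n G"
proof -
  have fin: "finite V" "finite K" using F K finite_subset by (auto simp: graph_on_def)
  obtain f where f: "inj_on f V" "f ` V \<subseteq> K" using inj_on_iff_card_le[OF fin] K(2) by auto
  have "f ` e \<in> G" if edge: "e \<in> E" for e
  proof -
    obtain u v where "e = {u, v}" "u \<noteq> v" "u \<in> V" "v \<in> V"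
      using graph_on_edgeE[OF F edge] .
    then have "f ` e \<in> [K]\<^bsup>2\<^esup>" using f by (auto dest: inj_onD)
    then show ?thesis using K(3) by blast
  qed
  then show ?thesis unfolding contains_copy_def using f K by blast
qed

lemma triangles_eq_card_triangle_set:
  assumes "host_graph n G"
  shows "triangles n G = card (triangle_set G)"
proof -
  have "[T]\<^bsup>2\<^esup> \<subseteq> G \<longleftrightarrow> (\<forall>x\<in>T. \<forall>y\<in>T. x \<noteq> y \<longrightarrow> {x, y} \<in> G)" for T
    by (auto elim!: nsets2_E)
  moreover have "T \<subseteq> {..<n}" if "T \<in> triangle_set G" for T
    using that triangle_set_subset_nsets[of G "{..<n}"] assms
    by (auto simp: host_graph_iff nsets_def)
  ultimately show ?thesis
    unfolding triangles_def triangle_set_def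
    by (intro arg_cong[where f = card] Collect_cong) blast
qed

lemma card_triangle_set_le_ex_K3:
  assumes "host_graph n G" "\<not> contains_copy V E n G"
  shows "card (triangle_set G) \<le> ex_K3 V E n"
proof -
  have "triangles n G' \<le> card ([{..<n}]\<^bsup>3\<^esup>)" if "host_graph n G'" for G'
    using that triangle_set_subset_nsets[of G' "{..<n}"]
    unfolding triangles_eq_card_triangle_set[OF that] host_graph_iff
    by (intro card_mono finite_imp_finite_nsets) auto
  then have "bdd_above {triangles n G' |G'. host_graph n G' \<and> \<not> contains_copy V E n G'}"
    by (intro bdd_aboveI[of _ "card ([{..<n}]\<^bsup>3\<^esup>)"]) auto
  then show ?thesis
    unfolding ex_K3_def triangles_eq_card_triangle_set[OF assms(1), symmetric]
    using assms by (intro cSup_upper) auto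
qed

section \<open>Berge copies and heavy pairs\<close>

text \<open>The members of \<open>L\<close> need not be pairs: hyperedges are first assigned to triangles and then
  inherited by the edges selected from these triangles.\<close>

definition berge_core :: "'a set set \<Rightarrow> 'a set set \<Rightarrow> bool" where
  "berge_core L H \<longleftrightarrow> (\<exists>g. inj_on g L \<and> (\<forall>p\<in>L. g p \<in> H \<and> p \<subseteq> g p))"

lemma berge_core_subset: "berge_core L H \<Longrightarrow> L' \<subseteq> L \<Longrightarrow> berge_core L' H"
  unfolding berge_core_def by (meson inj_on_subset subsetD)

lemma berge_core_if_subset: "L \<subseteq> H \<Longrightarrow> berge_core L H"
  unfolding berge_core_def by (intro exI[of _ id]) auto

lemma berge_core_image:
  assumes "berge_core L H" "\<And>p. p \<in> L \<Longrightarrow> f p \<subseteq> p"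
  shows "berge_core (f ` L) H"
proof -
  obtain g where g: "inj_on g L" "\<And>p. p \<in> L \<Longrightarrow> g p \<in> H \<and> p \<subseteq> g p"
    using assms(1) by (auto simp: berge_core_def)
  have inv: "inv_into L f q \<in> L" "f (inv_into L f q) = q" if "q \<in> f ` L" for q
    using that by (simp_all add: inv_into_into f_inv_into_f)
  have "inj_on (g \<circ> inv_into L f) (f ` L)"
    using g(1) inv by (intro comp_inj_on inj_on_inv_into) (auto intro: inj_on_subset)
  moreover have "(g \<circ> inv_into L f) q \<in> H \<and> q \<subseteq> (g \<circ> inv_into L f) q" if "q \<in> f ` L" for q
    using g(2)[OF inv(1)[OF that]] assms(2)[OF inv(1)[OF that]] inv(2)[OF that] by auto
  ultimately show ?thesis unfolding berge_core_def by blast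
qed

lemma berge_core_insert:
  assumes L: "berge_core L H" "finite L" and deg: "card L < card {h \<in> H. p \<subseteq> h}"
  shows "berge_core (insert p L) H"
proof (cases "p \<in> L")
  case False
  obtain g where g: "inj_on g L" "\<forall>p\<in>L. g p \<in> H \<and> p \<subseteq> g p"
    using L(1) by (auto simp: berge_core_def)
  have "card (g ` L) < card {h \<in> H. p \<subseteq> h}" using card_image_le[OF L(2), of g] deg by linarith
  then have "\<not> {h \<in> H. p \<subseteq> h} \<subseteq> g ` L" using L(2) by (meson card_mono finite_imageI not_le)
  then obtain h where "h \<in> H" "p \<subseteq> h" "h \<notin> g ` L" by blast
  then show ?thesis
    unfolding berge_core_def using False g by (intro exI[of _ "g(p := h)"]) (auto simp: inj_on_def)
qed (use L in \<open>simp add: insert_absorb\<close>)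

definition heavy_pairs :: "nat \<Rightarrow> 'a set set \<Rightarrow> 'a set set" where
  "heavy_pairs m H = {p. card p = 2 \<and> m \<le> card {h \<in> H. p \<subseteq> h}}"

lemma berge_core_Un_heavy:
  assumes "finite A" "A \<subseteq> heavy_pairs m H" "berge_core L H" "finite L" "card (A \<union> L) \<le> m"
  shows "berge_core (A \<union> L) H"
  using assms(1,2,5)
proof (induction A)
  case (insert a A)
  show ?case
  proof (cases "a \<in> A \<union> L")
    case True
    then show ?thesis using insert by (simp add: insert_absorb)
  next
    case False
    then have "card (A \<union> L) < card (insert a A \<union> L)" using insert.hyps assms(4) by simp
    then have "card (A \<union> L) < m" using insert.prems(2) by linarith
    moreover from this have "berge_core (A \<union> L) H" using insert by simp
    ultimately show ?thesis
      using insert.prems(1) insert.hyps(1) assms(4) berge_core_insert[of "A \<union> L" H a]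
      by (simp add: heavy_pairs_def)
  qed
qed (use assms in simp)

lemma contains_berge_if_core:
  assumes F: "graph_on V E" and \<phi>: "inj_on \<phi> V" "\<phi> ` V \<subseteq> {..<n}"
    and core: "berge_core ((`) \<phi> ` E) H"
  shows "contains_berge V E n H"
proof -
  obtain g where g: "inj_on g ((`) \<phi> ` E)" "\<And>e. e \<in> E \<Longrightarrow> g (\<phi> ` e) \<in> H \<and> \<phi> ` e \<subseteq> g (\<phi> ` e)"
    using core by (auto simp: berge_core_def)
  have "E \<subseteq> Pow V" using F by (auto simp: graph_on_def)
  then have "inj_on ((`) \<phi>) E" using \<phi>(1) by (meson inj_on_image_Pow inj_on_subset)
  then have "inj_on (\<lambda>e. g (\<phi> ` e)) E"
    using g(1) comp_inj_on[of "(`) \<phi>" E g] by (simp add: comp_def)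
  then show ?thesis using g(2) \<phi> unfolding contains_berge_def by blast
qed

lemma contains_berge_if_copy_heavy_Un_core:
  assumes F: "graph_on V E" and core: "berge_core L H"
    and copy: "contains_copy V E n (heavy_pairs (card E) H \<union> L)"
  shows "contains_berge V E n H"
proof -
  obtain \<phi> where \<phi>: "inj_on \<phi> V" "\<phi> ` V \<subseteq> {..<n}" "\<And>e. e \<in> E \<Longrightarrow> \<phi> ` e \<in> heavy_pairs (card E) H \<union> L"
    using copy unfolding contains_copy_def by blast
  define E' where "E' = (`) \<phi> ` E"
  have "finite E" using F by (rule finite_edges)
  then have E': "finite E'" "card E' \<le> card E" by (simp_all add: E'_def card_image_le)
  have split: "E' = (E' \<inter> heavy_pairs (card E) H) \<union> (E' \<inter> L)" using \<phi>(3) by (auto simp: E'_def)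
  have "berge_core ((E' \<inter> heavy_pairs (card E) H) \<union> (E' \<inter> L)) H"
    using E' split
    by (intro berge_core_Un_heavy[where m = "card E"] berge_core_subset[OF core]) auto
  then have "berge_core E' H" using split by simp
  then show ?thesis unfolding E'_def by (rule contains_berge_if_core[OF F \<phi>(1,2)])
qed

locale berge_free_hypergraph =
  fixes V :: "'a set" and E :: "'a set set" and r n :: nat and H :: "nat set set"
  assumes graph: "graph_on V E" and edges: "E \<noteq> {}"
    and uniform: "uniform_hypergraph r n H" and berge_free: "\<not> contains_berge V E n H"
begin

abbreviation heavy :: "nat set set" where
  "heavy \<equiv> heavy_pairs (card E) H"

definition cherry_hyperedges :: "nat set set" where
  "cherry_hyperedges = {h \<in> H. has_cherry heavy h}"

definition light_triangle_hyperedges :: "nat set set" where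
  "light_triangle_hyperedges = {h \<in> H. \<exists>T\<in>[h]\<^bsup>3\<^esup>. [T]\<^bsup>2\<^esup> \<inter> heavy = {}}"

lemma card_E_pos: "0 < card E"
  using edges finite_edges[OF graph] by (simp add: card_gt_0_iff)

lemma hyperedge:
  assumes "h \<in> H"
  shows "h \<subseteq> {..<n}" "card h = r" "finite h"
  using assms uniform by (auto simp: uniform_hypergraph_def intro: finite_subset)

lemma finite_H: "finite H"
  by (rule finite_subset[of _ "Pow {..<n}"]) (use hyperedge in auto)

lemma heavy_subset_nsets: "heavy \<subseteq> [{..<n}]\<^bsup>2\<^esup>"
proof
  fix p assume p: "p \<in> heavy"
  then have "0 < card {h \<in> H. p \<subseteq> h}" using card_E_pos by (simp add: heavy_pairs_def)
  then obtain h where "h \<in> H" "p \<subseteq> h" by (fastforce simp: card_gt_0_iff)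
  then show "p \<in> [{..<n}]\<^bsup>2\<^esup>"
    using p hyperedge(1)[of h] by (auto simp: heavy_pairs_def nsets_def card_ge_0_finite)
qed

lemma card_hyperedges_containing_light_le:
  assumes "card p = 2" "p \<notin> heavy"
  shows "card {h \<in> H. p \<subseteq> h} \<le> card E"
  using assms by (simp add: heavy_pairs_def)

lemma core_subset_nsets:
  assumes "berge_core L H" "\<And>p. p \<in> L \<Longrightarrow> card p = k" "0 < k"
  shows "L \<subseteq> [{..<n}]\<^bsup>k\<^esup>"
proof
  fix p assume "p \<in> L"
  moreover from this obtain h where "h \<in> H" "p \<subseteq> h" using assms(1) by (auto simp: berge_core_def)
  ultimately show "p \<in> [{..<n}]\<^bsup>k\<^esup>"
    using assms(2,3) hyperedge(1) by (auto simp: nsets_def card_ge_0_finite)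
qed

lemma copy_free_heavy_Un_core: "berge_core L H \<Longrightarrow> \<not> contains_copy V E n (heavy \<union> L)"
  using contains_berge_if_copy_heavy_Un_core[OF graph] berge_free by blast

lemma card_triangle_set_heavy_Un_core_le:
  assumes "berge_core L H" "\<And>p. p \<in> L \<Longrightarrow> card p = 2"
  shows "card (triangle_set (heavy \<union> L)) \<le> ex_K3 V E n"
proof (rule card_triangle_set_le_ex_K3)
  show "host_graph n (heavy \<union> L)"
    unfolding host_graph_iff using heavy_subset_nsets core_subset_nsets[OF assms] by simp
qed (rule copy_free_heavy_Un_core[OF assms(1)])

lemma card_heavy_clique_less:
  assumes "K \<subseteq> {..<n}" "[K]\<^bsup>2\<^esup> \<subseteq> heavy"
  shows "card K < card V"
proof (rule ccontr)
  assume "\<not> ?thesis"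
  then have "contains_copy V E n (heavy \<union> {})"
    using assms by (intro contains_copy_clique[OF graph]) auto
  moreover have "berge_core {} H" by (rule berge_core_if_subset) simp
  ultimately show False using copy_free_heavy_Un_core by blast
qed

lemma card_le_light_representatives:
  assumes sub: "S \<subseteq> H" and light: "\<And>h. h \<in> S \<Longrightarrow> p h \<in> [h]\<^bsup>2\<^esup> - heavy"
  shows "berge_core (p ` S) H" "card S \<le> card (p ` S) * card E"
proof -
  have p: "p h \<subseteq> h" "card (p h) = 2" "p h \<notin> heavy" if "h \<in> S" for h
    using light[OF that] by (auto simp: nsets_def)
  show "berge_core (p ` S) H" by (intro berge_core_image berge_core_if_subset sub p)
  have fin: "finite S" using sub finite_H by (rule finite_subset)
  show "card S \<le> card (p ` S) * card E"
  proof (rule card_le_mult_if_card_fibers_le[where f = p])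
    fix e assume "e \<in> p ` S"
    then have e: "card e = 2" "e \<notin> heavy" using p by auto
    have "card {h \<in> S. p h = e} \<le> card {h \<in> H. e \<subseteq> h}"
      using finite_H sub p by (intro card_mono) auto
    also have "\<dots> \<le> card E" using e by (rule card_hyperedges_containing_light_le)
    finally show "card {h \<in> S. p h = e} \<le> card E" .
  qed (use fin in auto)
qed

lemma card_le_copy_free_graph:
  assumes "card V \<le> r"
  shows "\<exists>G. host_graph n G \<and> \<not> contains_copy V E n G \<and> card H \<le> card G * card E"
proof -
  have "\<exists>p. p \<in> [h]\<^bsup>2\<^esup> - heavy" if "h \<in> H" for h
    using card_heavy_clique_less[of h] hyperedge[OF that] assms by auto
  then obtain p where p: "\<And>h. h \<in> H \<Longrightarrow> p h \<in> [h]\<^bsup>2\<^esup> - heavy" by metis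
  note rep = card_le_light_representatives[OF subset_refl p]
  have "host_graph n (p ` H)"
    unfolding host_graph_iff using p by (intro core_subset_nsets rep) (auto simp: nsets_def)
  moreover have "\<not> contains_copy V E n (p ` H)"
    using copy_free_heavy_Un_core[OF rep(1)] unfolding contains_copy_def by blast
  ultimately show ?thesis using rep(2) by blast
qed

lemma card_cherry_hyperedges_le: "card cherry_hyperedges \<le> 3 * ex_K3 V E n * card E"
proof -
  have "\<exists>p w. p \<in> [h]\<^bsup>2\<^esup> - heavy \<and> w \<notin> p \<and> (\<forall>x\<in>p. {x, w} \<in> heavy)" if "h \<in> cherry_hyperedges" for h
    using that by (auto simp: cherry_hyperedges_def has_cherry_def)
  then obtain p w where p: "\<And>h. h \<in> cherry_hyperedges \<Longrightarrow> p h \<in> [h]\<^bsup>2\<^esup> - heavy"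
    and w: "\<And>h. h \<in> cherry_hyperedges \<Longrightarrow> w h \<notin> p h \<and> (\<forall>x\<in>p h. {x, w h} \<in> heavy)" by metis
  define L where "L = p ` cherry_hyperedges"
  have "cherry_hyperedges \<subseteq> H" by (auto simp: cherry_hyperedges_def)
  then have L: "berge_core L H" "card cherry_hyperedges \<le> card L * card E"
    unfolding L_def using p by (auto intro!: card_le_light_representatives)
  have card_L: "card e = 2" if "e \<in> L" for e using that p by (auto simp: L_def nsets_def)
  have "\<exists>T\<in>triangle_set (heavy \<union> L). e \<subseteq> T" if e: "e \<in> L" for e
  proof -
    obtain h where h: "h \<in> cherry_hyperedges" "e = p h" using e by (auto simp: L_def)
    obtain x y where xy: "e = {x, y}" "x \<noteq> y" using card_L[OF e] by (auto simp: card_2_iff)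
    have "x \<noteq> w h" "y \<noteq> w h" "{x, w h} \<in> heavy" "{y, w h} \<in> heavy" "{x, y} \<in> L"
      using w[OF h(1)] h(2) xy(1) e by auto
    then have "{x, y, w h} \<in> triangle_set (heavy \<union> L)"
      unfolding triangle_set_iff using xy(2) by blast
    then show ?thesis using xy(1) by (intro bexI[of _ "{x, y, w h}"]) auto
  qed
  moreover have "finite (triangle_set (heavy \<union> L))"
    using heavy_subset_nsets core_subset_nsets[OF L(1) card_L]
    by (intro finite_triangle_set[of "{..<n}"]) auto
  ultimately have "card L \<le> 3 * card (triangle_set (heavy \<union> L))"
    using card_L by (intro card_edges_in_triangles_le)
  also have "\<dots> \<le> 3 * ex_K3 V E n"
    using card_triangle_set_heavy_Un_core_le[OF L(1) card_L] by simp
  finally show ?thesis using L(2) by (meson le_trans mult_le_mono1)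
qed

lemma card_hyperedges_meeting_light_triangle_le:
  assumes "card T = 3" "[T]\<^bsup>2\<^esup> \<inter> heavy = {}"
  shows "card {h \<in> H. \<exists>p\<in>[T]\<^bsup>2\<^esup>. p \<subseteq> h} \<le> 3 * card E"
proof -
  have fin: "finite ([T]\<^bsup>2\<^esup>)"
    using assms(1) by (intro finite_imp_finite_nsets card_ge_0_finite) simp
  have "{h \<in> H. \<exists>p\<in>[T]\<^bsup>2\<^esup>. p \<subseteq> h} = (\<Union>p\<in>[T]\<^bsup>2\<^esup>. {h \<in> H. p \<subseteq> h})" by auto
  then have "card {h \<in> H. \<exists>p\<in>[T]\<^bsup>2\<^esup>. p \<subseteq> h} \<le> (\<Sum>p\<in>[T]\<^bsup>2\<^esup>. card {h \<in> H. p \<subseteq> h})"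
    using card_UN_le[OF fin] by simp
  also have "\<dots> \<le> (\<Sum>p\<in>[T]\<^bsup>2\<^esup>. card E)"
    using assms(2) by (intro sum_mono card_hyperedges_containing_light_le) (auto simp: nsets_def)
  also have "\<dots> = 3 * card E" using assms(1) by (simp add: choose_two)
  finally show ?thesis .
qed

lemma exists_edge_disjoint_subfamily:
  assumes sub: "S \<subseteq> H"
    and light: "\<And>h. h \<in> S \<Longrightarrow> t h \<in> [h]\<^bsup>3\<^esup>" "\<And>h. h \<in> S \<Longrightarrow> [t h]\<^bsup>2\<^esup> \<inter> heavy = {}"
  shows "\<exists>I\<subseteq>S. disjoint_family_on (\<lambda>h. [t h]\<^bsup>2\<^esup>) I \<and> card S \<le> card I * (3 * card E)"
proof -
  let ?conflict = "\<lambda>x y. [t x]\<^bsup>2\<^esup> \<inter> [t y]\<^bsup>2\<^esup> \<noteq> {}"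
  have triple: "t h \<subseteq> h" "card (t h) = 3" if "h \<in> S" for h
    using light(1)[OF that] by (auto simp: nsets_def)
  have "card {y \<in> S. y = x \<or> ?conflict x y} \<le> 3 * card E" if x: "x \<in> S" for x
  proof -
    have "\<exists>p\<in>[t x]\<^bsup>2\<^esup>. p \<subseteq> y" if y: "y \<in> S" "y = x \<or> ?conflict x y" for y
    proof -
      have "[t x]\<^bsup>2\<^esup> \<noteq> {}" using triple(2)[OF x] by (auto simp: nsets_eq_empty_iff)
      then obtain p where "p \<in> [t x]\<^bsup>2\<^esup>" "p \<in> [t y]\<^bsup>2\<^esup>" using y(2) by blast
      then show ?thesis using triple(1)[OF y(1)] by (auto simp: nsets_def)
    qed
    then have "{y \<in> S. y = x \<or> ?conflict x y} \<subseteq> {h \<in> H. \<exists>p\<in>[t x]\<^bsup>2\<^esup>. p \<subseteq> h}" using sub by auto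
    then have "card {y \<in> S. y = x \<or> ?conflict x y} \<le> card {h \<in> H. \<exists>p\<in>[t x]\<^bsup>2\<^esup>. p \<subseteq> h}"
      using finite_H by (intro card_mono) auto
    also have "\<dots> \<le> 3 * card E"
      using triple(2)[OF x] light(2)[OF x] by (rule card_hyperedges_meeting_light_triangle_le)
    finally show ?thesis .
  qed
  moreover have "finite S" using sub finite_H by (rule finite_subset)
  ultimately obtain I where "I \<subseteq> S" "pairwise (\<lambda>x y. \<not> ?conflict x y) I"
    "card S \<le> card I * (3 * card E)"
    using exists_independent_set[of S ?conflict "3 * card E"] by blast
  then show ?thesis by (intro exI[of _ I]) (auto simp: pairwise_def disjoint_family_on_def)
qed

lemma exists_edge_disjoint_light_triangles:
  "\<exists>\<T>\<subseteq>[{..<n}]\<^bsup>3\<^esup>. berge_core \<T> H \<and> edge_disjoint \<T> \<and>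
    card light_triangle_hyperedges \<le> card \<T> * (3 * card E)"
proof -
  have "\<exists>T. T \<in> [h]\<^bsup>3\<^esup> \<and> [T]\<^bsup>2\<^esup> \<inter> heavy = {}" if "h \<in> light_triangle_hyperedges" for h
    using that by (auto simp: light_triangle_hyperedges_def)
  then obtain t where light: "\<And>h. h \<in> light_triangle_hyperedges \<Longrightarrow> t h \<in> [h]\<^bsup>3\<^esup>"
    "\<And>h. h \<in> light_triangle_hyperedges \<Longrightarrow> [t h]\<^bsup>2\<^esup> \<inter> heavy = {}" by metis
  have sub: "light_triangle_hyperedges \<subseteq> H" by (auto simp: light_triangle_hyperedges_def)
  obtain I where I: "I \<subseteq> light_triangle_hyperedges"
    "card light_triangle_hyperedges \<le> card I * (3 * card E)"
    and disj: "disjoint_family_on (\<lambda>h. [t h]\<^bsup>2\<^esup>) I"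
    using exists_edge_disjoint_subfamily[OF sub light] by blast
  have triple: "t h \<subseteq> h" "card (t h) = 3" if "h \<in> I" for h
    using light(1)[of h] that I(1) by (auto simp: nsets_def)
  have "[t h]\<^bsup>2\<^esup> \<noteq> {}" if "h \<in> I" for h
    using triple(2)[OF that] by (auto simp: nsets_eq_empty_iff)
  then have inj: "inj_on t I"
    using disjoint_family_onD[OF disj] by (intro inj_onI) (metis inf.idem)
  have core: "berge_core (t ` I) H"
    using triple(1) I(1) sub by (intro berge_core_image berge_core_if_subset) auto
  moreover have "t ` I \<subseteq> [{..<n}]\<^bsup>3\<^esup>"
    using triple(2) by (intro core_subset_nsets[OF core]) auto
  moreover have "edge_disjoint (t ` I)"
    using disj by (fastforce simp: disjoint_family_on_def)
  moreover have "card (t ` I) = card I" by (rule card_image[OF inj])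
  ultimately show ?thesis using I(2) by (intro exI[of _ "t ` I"]) simp
qed

lemma card_triangle_set_edge_disjoint_core_le:
  assumes \<T>: "\<T> \<subseteq> [{..<n}]\<^bsup>3\<^esup>" "berge_core \<T> H" "edge_disjoint \<T>"
  shows "card (triangle_set (shadow \<T>)) \<le> n\<^sup>2 + 27 * ex_K3 V E n"
proof -
  let ?G = "shadow \<T>"
  have fin: "finite \<T>" using \<T>(1) by (rule finite_subset) (simp add: finite_imp_finite_nsets)
  have "card T = 3" if "T \<in> \<T>" for T using \<T>(1) that by (auto simp: nsets_def)
  then obtain a where a: "a \<in> (\<Pi>\<^sub>E T\<in>\<T>. [T]\<^bsup>2\<^esup>)"
    and rainbow: "card (triangle_set ?G - \<T>) \<le> 27 * card (triangle_set (a ` \<T>))"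
    using exists_transversal_many_triangles[OF fin _ \<T>(3)] by blast
  have representative: "a T \<subseteq> T" "card (a T) = 2" if "T \<in> \<T>" for T
    using PiE_mem[OF a that] by (auto simp: nsets_def)
  have core: "berge_core (a ` \<T>) H" using \<T>(2) representative(1) by (rule berge_core_image)
  have "a ` \<T> \<subseteq> [{..<n}]\<^bsup>2\<^esup>" using representative(2) by (intro core_subset_nsets[OF core]) auto
  then have "card (triangle_set (a ` \<T>)) \<le> card (triangle_set (heavy \<union> a ` \<T>))"
    using heavy_subset_nsets
    by (intro card_mono finite_triangle_set[of "{..<n}"] triangle_set_mono) auto
  also have "\<dots> \<le> ex_K3 V E n"
    using core representative(2) by (intro card_triangle_set_heavy_Un_core_le) auto
  finally have "card (triangle_set ?G - \<T>) \<le> 27 * ex_K3 V E n" using rainbow by linarith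
  moreover have "card \<T> \<le> n\<^sup>2"
  proof -
    have "3 * card \<T> \<le> n * (n - 1) div 2"
      using card_edge_disjoint_triples_le[OF _ \<T>(1,3)] by (simp add: choose_two)
    also have "\<dots> \<le> n * n" by (meson div_le_dividend diff_le_self le_trans mult_le_mono2)
    finally show ?thesis by (simp add: power2_eq_square)
  qed
  moreover have "card (triangle_set ?G) \<le> card (triangle_set ?G - \<T>) + card \<T>"
    using diff_card_le_card_Diff[OF fin, of "triangle_set ?G"] by linarith
  ultimately show ?thesis by linarith
qed

lemma exists_edge_disjoint_triangles_card_le:
  assumes "2 * (card V - 1) < r"
  shows "\<exists>\<T>\<subseteq>[{..<n}]\<^bsup>3\<^esup>. edge_disjoint \<T> \<and>
    card (triangle_set (shadow \<T>)) \<le> n\<^sup>2 + 27 * ex_K3 V E n \<and>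
    card H \<le> 3 * card E * (ex_K3 V E n + card \<T>)"
proof -
  have "h \<in> light_triangle_hyperedges" if h: "h \<in> H" "\<not> has_cherry heavy h" for h
  proof -
    have "card K \<le> card V - 1" if "K \<subseteq> h" "[K]\<^bsup>2\<^esup> \<subseteq> heavy" for K
    proof -
      have "card K < card V" using card_heavy_clique_less that hyperedge(1)[OF h(1)] by blast
      then show ?thesis by simp
    qed
    then have "\<exists>T\<in>[h]\<^bsup>Suc 2\<^esup>. [T]\<^bsup>2\<^esup> \<inter> heavy = {}"
      using assms hyperedge(2,3)[OF h(1)] h(2)
      by (intro exists_independent_set_if_no_cherry[where k = "card V - 1"]) auto
    then show ?thesis using h(1) by (simp add: light_triangle_hyperedges_def eval_nat_numeral)
  qed
  then have "cherry_hyperedges \<union> light_triangle_hyperedges = H"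
    by (auto simp: cherry_hyperedges_def light_triangle_hyperedges_def)
  then have "card H \<le> card cherry_hyperedges + card light_triangle_hyperedges"
    using card_Un_le[of cherry_hyperedges light_triangle_hyperedges] by simp
  moreover obtain \<T> where \<T>: "\<T> \<subseteq> [{..<n}]\<^bsup>3\<^esup>" "berge_core \<T> H" "edge_disjoint \<T>"
    and "card light_triangle_hyperedges \<le> card \<T> * (3 * card E)"
    using exists_edge_disjoint_light_triangles by blast
  ultimately have "card H \<le> 3 * ex_K3 V E n * card E + card \<T> * (3 * card E)"
    using card_cherry_hyperedges_le by linarith
  then have "card H \<le> 3 * card E * (ex_K3 V E n + card \<T>)" by (simp add: algebra_simps)
  then show ?thesis using \<T> card_triangle_set_edge_disjoint_core_le[OF \<T>] by blast
qed

end

section \<open>The uniformity threshold\<close>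

lemma ex_berge_smalloI:
  assumes "\<And>c :: real. 0 < c \<Longrightarrow> \<forall>\<^sub>F n in sequentially. \<forall>H. uniform_hypergraph r n H \<longrightarrow>
    \<not> contains_berge V E n H \<longrightarrow> card H \<le> c * (real n)\<^sup>2"
  shows "(\<lambda>n. real (ex_berge V E r n)) \<in> o(\<lambda>n. real n ^ 2)"
proof (rule landau_o.smallI)
  fix c :: real assume c_pos: "0 < c"
  show "\<forall>\<^sub>F n in sequentially. norm (real (ex_berge V E r n)) \<le> c * norm (real n ^ 2)"
    using assms[OF c_pos]
  proof eventually_elim
    case (elim n)
    let ?X = "{card H |H. uniform_hypergraph r n H \<and> \<not> contains_berge V E n H}"
    have "Sup ?X \<le> nat \<lfloor>c * (real n)\<^sup>2\<rfloor>"
    proof (cases "?X = {}")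
      case True
      then show ?thesis by (simp only: Sup_nat_empty)
    next
      case False
      then show ?thesis using elim by (intro cSup_least) (auto intro: le_nat_floor)
    qed
    then have "real (ex_berge V E r n) \<le> c * (real n)\<^sup>2"
      unfolding ex_berge_def using c_pos by (simp add: le_nat_iff le_floor_iff)
    then show ?case by simp
  qed
qed

lemma ex_berge_smallo_edgeless:
  assumes "finite V"
  shows "(\<lambda>n. real (ex_berge V {} r n)) \<in> o(\<lambda>n. real n ^ 2)"
proof (rule ex_berge_smalloI)
  fix c :: real
  have "contains_berge V {} n H" if "card V \<le> n" for n H
    using that inj_on_iff_card_le[OF assms, of "{..<n}"] by (auto simp: contains_berge_def)
  then show "\<forall>\<^sub>F n in sequentially. \<forall>H. uniform_hypergraph r n H \<longrightarrow>
      \<not> contains_berge V {} n H \<longrightarrow> card H \<le> c * (real n)\<^sup>2"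
    unfolding eventually_sequentially by (intro exI[of _ "card V"]) simp
qed

lemma ex_berge_smallo_bipartite:
  assumes F: "graph_on V E" "E \<noteq> {}" and col: "proper_coloring V E 2 col" and r: "card V \<le> r"
  shows "(\<lambda>n. real (ex_berge V E r n)) \<in> o(\<lambda>n. real n ^ 2)"
proof (rule ex_berge_smalloI)
  fix c :: real assume c_pos: "0 < c"
  have card_E_pos: "0 < real (card E)" using F finite_edges by (auto simp: card_gt_0_iff)
  then have "0 < c / card E" using c_pos by simp
  then have "\<forall>\<^sub>F n in sequentially. \<forall>G. host_graph n G \<longrightarrow> c / card E * (real n)\<^sup>2 \<le> card G \<longrightarrow>
      contains_copy V E n G"
    by (rule dense_graph_contains_bipartite[OF F(1) col])
  then show "\<forall>\<^sub>F n in sequentially. \<forall>H. uniform_hypergraph r n H \<longrightarrow>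
      \<not> contains_berge V E n H \<longrightarrow> card H \<le> c * (real n)\<^sup>2"
  proof (eventually_elim, intro allI impI)
    fix n H
    assume dense: "\<forall>G. host_graph n G \<longrightarrow> c / card E * (real n)\<^sup>2 \<le> card G \<longrightarrow> contains_copy V E n G"
      and "uniform_hypergraph r n H" "\<not> contains_berge V E n H"
    then interpret berge_free_hypergraph V E r n H using F by unfold_locales
    obtain G where G: "host_graph n G" "\<not> contains_copy V E n G" "card H \<le> card G * card E"
      using card_le_copy_free_graph[OF r] by blast
    then have "card G \<le> c / card E * (real n)\<^sup>2" using dense by fastforce
    then have "card G * card E \<le> c * (real n)\<^sup>2" using card_E_pos by (simp add: field_simps)
    then show "card H \<le> c * (real n)\<^sup>2" using of_nat_mono[OF G(3), where 'a = real] by linarith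
  qed
qed

lemma ex_berge_smallo_if_ex_K3_smallo:
  assumes F: "graph_on V E" "E \<noteq> {}" and ex: "(\<lambda>n. real (ex_K3 V E n)) \<in> o(\<lambda>n. real n ^ 2)"
    and r: "2 * (card V - 1) < r"
  shows "(\<lambda>n. real (ex_berge V E r n)) \<in> o(\<lambda>n. real n ^ 2)"
proof (rule ex_berge_smalloI)
  fix c :: real assume c_pos: "0 < c"
  have card_E_pos: "0 < real (card E)" using F finite_edges by (auto simp: card_gt_0_iff)
  define \<epsilon> where "\<epsilon> = min 1 (c / (6 * card E))"
  have \<epsilon>: "0 < \<epsilon>" "\<epsilon> \<le> 1" "6 * card E * \<epsilon> \<le> c"
    using c_pos card_E_pos by (auto simp: \<epsilon>_def min_def field_simps)
  have "\<forall>\<^sub>F n in sequentially. real (ex_K3 V E n) \<le> \<epsilon> * (real n)\<^sup>2"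
    using landau_o.smallD[OF ex \<epsilon>(1)] by simp
  then show "\<forall>\<^sub>F n in sequentially. \<forall>H. uniform_hypergraph r n H \<longrightarrow>
      \<not> contains_berge V E n H \<longrightarrow> card H \<le> c * (real n)\<^sup>2"
    using edge_disjoint_triangles_sparse[OF \<epsilon>(1), of 28]
  proof (eventually_elim, intro allI impI)
    fix n H
    assume ex_n: "real (ex_K3 V E n) \<le> \<epsilon> * (real n)\<^sup>2"
      and sparse: "\<forall>\<T>. \<T> \<subseteq> [{..<n}]\<^bsup>3\<^esup> \<longrightarrow> edge_disjoint \<T> \<longrightarrow>
        card (triangle_set (shadow \<T>)) \<le> 28 * (real n)\<^sup>2 \<longrightarrow> card \<T> \<le> \<epsilon> * (real n)\<^sup>2"
      and "uniform_hypergraph r n H" "\<not> contains_berge V E n H"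
    then interpret berge_free_hypergraph V E r n H using F by unfold_locales
    obtain \<T> where \<T>: "\<T> \<subseteq> [{..<n}]\<^bsup>3\<^esup>" "edge_disjoint \<T>"
      and few: "card (triangle_set (shadow \<T>)) \<le> n\<^sup>2 + 27 * ex_K3 V E n"
      and H: "card H \<le> 3 * card E * (ex_K3 V E n + card \<T>)"
      using exists_edge_disjoint_triangles_card_le[OF r] by blast
    have "\<epsilon> * (real n)\<^sup>2 \<le> 1 * (real n)\<^sup>2" using \<epsilon>(2) by (rule mult_right_mono) simp
    then have "card (triangle_set (shadow \<T>)) \<le> 28 * (real n)\<^sup>2"
      using of_nat_mono[OF few, where 'a = real] ex_n by simp
    then have "card \<T> \<le> \<epsilon> * (real n)\<^sup>2" using sparse \<T> by blast
    then have "3 * card E * (real (ex_K3 V E n) + card \<T>)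
        \<le> 3 * card E * (\<epsilon> * (real n)\<^sup>2 + \<epsilon> * (real n)\<^sup>2)"
      using ex_n by (intro mult_left_mono add_mono) auto
    also have "\<dots> = 6 * card E * \<epsilon> * (real n)\<^sup>2" by simp
    also have "\<dots> \<le> c * (real n)\<^sup>2" using \<epsilon>(3) by (rule mult_right_mono) simp
    finally show "card H \<le> c * (real n)\<^sup>2" using of_nat_mono[OF H, where 'a = real] by simp
  qed
qed

lemma ex_berge_smallo:
  assumes "graph_on V E"
    and "(\<lambda>n. real (ex_K3 V E n)) \<in> o(\<lambda>n. real n ^ 2)"
    and r: "(chromatic_number V E - 1) * (card V - 1) < r"
  shows "(\<lambda>n. real (ex_berge V E r n)) \<in> o(\<lambda>n. real n ^ 2)"
proof -
  consider (edgeless) "E = {}" | (bipartite) "E \<noteq> {}" "chromatic_number V E = 2"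
    | (nonbipartite) "E \<noteq> {}" "3 \<le> chromatic_number V E"
    using chromatic_number_ge_2[OF assms(1)] by fastforce
  then show ?thesis
  proof cases
    case edgeless
    then show ?thesis using assms(1) ex_berge_smallo_edgeless by (auto simp: graph_on_def)
  next
    case bipartite
    then obtain c where "proper_coloring V E 2 c"
      using proper_coloring_chromatic_number[OF assms(1)] by metis
    moreover have "card V \<le> r" using r bipartite(2) by simp
    ultimately show ?thesis by (rule ex_berge_smallo_bipartite[OF assms(1) bipartite(1)])
  next
    case nonbipartite
    then have "2 * (card V - 1) \<le> (chromatic_number V E - 1) * (card V - 1)"
      by (intro mult_right_mono) auto
    then have "2 * (card V - 1) < r" using r by linarith
    then show ?thesis
      by (rule ex_berge_smallo_if_ex_K3_smallo[OF assms(1) nonbipartite(1) assms(2)])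
  qed
qed

theorem theorem5:
  fixes V :: "'a set" and E :: "'a set set"
  assumes "graph_on V E"
    and "(\<lambda>n. real (ex_K3 V E n)) \<in> o(\<lambda>n. real n ^ 2)"
  shows "threshold V E \<le> (chromatic_number V E - 1) * (card V - 1) + 1"
  unfolding threshold_def
proof (intro Least_le allI impI)
  fix r assume "(chromatic_number V E - 1) * (card V - 1) + 1 \<le> r"
  then have "(chromatic_number V E - 1) * (card V - 1) < r" by simp
  then show "(\<lambda>n. real (ex_berge V E r n)) \<in> o(\<lambda>n. real n ^ 2)"
    by (rule ex_berge_smallo[OF assms])
qed

end
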